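(* Let $c:\mathbb{R}^d\times\mathbb{R}^d\to\mathbb{R}_+$ be continuous. Let $(E,\Sigma,m)$ be a $\sigma$-finite measure space and let $\lambda\in E\mapsto(\mu_\lambda,\nu_\lambda)\in(\mathcal{P}(\mathbb{R}^d))^2$ be a measurable function such that for $m$-almost every $\lambda$, Assumption $H(\mu_\lambda,\nu_\lambda,c)$ holds, with optimal transport map $T_\lambda:\mathbb{R}^d\to\mathbb{R}^d$. Then there exists a function $(\lambda,x)\mapsto T(\lambda,x)$ from $E\times\mathbb{R}^d$ to $\mathbb{R}^d$ which is measurable with respect to $\Sigma\otimes\mathcal{B}(\mathbb{R}^d)$ and such that, for $m$-almost every $\lambda$, $$T(\lambda,x)=T_\lambda(x)\quad\text{for } \mu_\lambda\text{-almost every } x.$$ In particular, $(\lambda,x)\mapsto T_\lambda(x)$ is measurable with respect to the completion of $\Sigma\otimes\mathcal{B}(\mathbb{R}^d)$ with respect to the measure $m(d\lambda)\mu_\lambda(dx)$.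
   Context: $\mathcal{P}(\mathbb{R}^d)$ is the space of Borel probability measures on $\mathbb{R}^d$, endowed with the usual weak topology and its Borel $\sigma$-field; $\mathcal{B}(\mathbb{R}^d)$ is the Borel $\sigma$-field of $\mathbb{R}^d$. For $\mu,\nu\in\mathcal{P}(\mathbb{R}^d)$, a transference plan between $\mu$ and $\nu$ is a $\pi\in\mathcal{P}(\mathbb{R}^{2d})$ with first marginal $\mu$ and second marginal $\nu$. Put $I(\pi)=\int_{\mathbb{R}^{2d}}c(x,y)\,\pi(dx,dy)\in[0,+\infty]$. $\Pi_c^*(\mu,\nu)$ denotes the set of transference plans between $\mu$ and $\nu$ that minimize $I$ among all such plans, if this minimum is finite; if $I(\pi)=+\infty$ for every transference plan $\pi$ between $\mu$ and $\nu$, then $\Pi_c^*(\mu,\nu)=\emptyset$ by convention. Assumption $H(\mu,\nu,c)$ means: (a) $\mu$ does not give mass to sets with Hausdorff dimension smaller than or equal to $d-1$; (b) there exists a unique optimal transference plan $\pi\in\Pi_c^*(\mu,\nu)$, and it has the form $\pi(dx,dy)=\mu(dx)\otimes\delta_{T(x)}(dy)$ for a $\mu(dx)$-a.s. unique mapping $T:\mathbb{R}^d\to\mathbb{R}^d$. Such a $T$ is called an optimal transport map between $\mu$ and $\nu$ for the cost function $c$.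
   Formalization: The "in particular" clause fails for arbitrary versions of T_λ (T_λ(x)=x+1_{x=λ}, trivial Σ, Lebesgue marginals); it is proved for every function equal m(dλ)μ_λ(dx)-a.e. to T(λ,x), so for (λ,x)↦T_λ(x) whenever that equality holds. *)

theory Defs
  imports "HOL-Probability.Probability"
begin

definition weak_topology :: "'a::topological_space measure topology" where
  "weak_topology = topology_generated_by
     {{\<mu> \<in> space (prob_algebra borel). (\<integral>x. f x \<partial>\<mu>) \<in> U} | (f :: 'a \<Rightarrow> real) U.
        continuous_on UNIV f \<and> bounded (range f) \<and> open U}"

lemma topspace_weak_topology: "topspace weak_topology = space (prob_algebra borel)"
proof -
  have "space (prob_algebra borel) \<in>
     {{\<mu> \<in> space (prob_algebra borel). (\<integral>x. f x \<partial>\<mu>) \<in> U} | (f :: 'a \<Rightarrow> real) U.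
        continuous_on UNIV f \<and> bounded (range f) \<and> open U}"
    by (rule CollectI, rule exI[of _ "\<lambda>_. 0"], rule exI[of _ UNIV]) auto
  then show ?thesis
    unfolding weak_topology_def topology_generated_by_topspace by auto
qed

definition weak_borel :: "'a::topological_space measure measure" where
  "weak_borel = sigma (topspace weak_topology) {U. openin weak_topology U}"

text \<open>
  The measure \<open>M(dx) K x (dy)\<close>; \<open>M\<close> need not be finite. A set all of whose sections are
  \<open>K x\<close>-null need not be contained in a null set of this measure, so equality
  ``for almost every \<open>x\<close>, \<open>K x\<close>-almost everywhere'' is weaker than equality almost everywhere
  for \<open>kernel_prod M K\<close> (unless the functions compared are jointly measurable).
\<close>

definition kernel_prod ::
  "'a measure \<Rightarrow> ('a \<Rightarrow> 'b::topological_space measure) \<Rightarrow> ('a \<times> 'b) measure" where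
  "kernel_prod M K = M \<bind> (\<lambda>x. distr (K x) (M \<Otimes>\<^sub>M borel) (Pair x))"

lemma emeasure_kernel_prod:
  assumes K: "K \<in> M \<rightarrow>\<^sub>M prob_algebra borel" and ne: "space M \<noteq> {}"
    and A: "A \<in> sets (M \<Otimes>\<^sub>M borel)"
  shows "emeasure (kernel_prod M K) A = (\<integral>\<^sup>+x. emeasure (K x) (Pair x -` A) \<partial>M)"
proof -
  have K': "K \<in> M \<rightarrow>\<^sub>M subprob_algebra borel"
    using K by (rule measurable_prob_algebraD)
  have "(\<lambda>x. distr (K x) (M \<Otimes>\<^sub>M borel) (Pair x)) \<in> M \<rightarrow>\<^sub>M subprob_algebra (M \<Otimes>\<^sub>M borel)"
    by (rule measurable_distr2[OF _ K']) simp
  then have "emeasure (kernel_prod M K) A =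
      (\<integral>\<^sup>+x. emeasure (distr (K x) (M \<Otimes>\<^sub>M borel) (Pair x)) A \<partial>M)"
    unfolding kernel_prod_def by (rule emeasure_bind[OF ne _ A])
  also have "\<dots> = (\<integral>\<^sup>+x. emeasure (K x) (Pair x -` A) \<partial>M)"
  proof (rule nn_integral_cong)
    fix x assume x: "x \<in> space M"
    then have sK: "sets (K x) = sets borel"
      using K by (auto dest!: measurable_space simp: space_prob_algebra)
    then have "Pair x \<in> K x \<rightarrow>\<^sub>M M \<Otimes>\<^sub>M borel"
      using x measurable_Pair1'[of x M borel] by (simp cong: measurable_cong_sets)
    moreover have "space (K x) = UNIV"
      using sets_eq_imp_space_eq[OF sK] by simp
    ultimately show "emeasure (distr (K x) (M \<Otimes>\<^sub>M borel) (Pair x)) A = emeasure (K x) (Pair x -` A)"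
      using A by (simp add: emeasure_distr)
  qed
  finally show ?thesis .
qed

text \<open>
  Covering sets are required to be bounded because \<^const>\<open>diameter\<close> is unspecified on unbounded
  sets. For \<open>s = 0\<close> a nonempty set contributes \<open>1\<close> (counting measure), whereas \<open>0 powr 0 = 0\<close>.
\<close>

definition hausdorff_premeasure :: "real \<Rightarrow> real \<Rightarrow> 'a::metric_space set \<Rightarrow> ennreal" where
  "hausdorff_premeasure s \<delta> A =
     (INF U \<in> {U :: nat \<Rightarrow> 'a set.
                 A \<subseteq> (\<Union>i. U i) \<and> (\<forall>i. bounded (U i) \<and> diameter (U i) \<le> \<delta>)}.
        \<Sum>i. if U i = {} then 0 else if s = 0 then 1 else ennreal (diameter (U i) powr s))"

definition hausdorff_measure :: "real \<Rightarrow> 'a::metric_space set \<Rightarrow> ennreal" where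
  "hausdorff_measure s A = (SUP \<delta> \<in> {0<..}. hausdorff_premeasure s \<delta> A)"

definition hausdorff_dim :: "'a::metric_space set \<Rightarrow> ennreal" where
  "hausdorff_dim A = Inf {ennreal s | s. 0 \<le> s \<and> hausdorff_measure s A = 0}"

definition transference_plans ::
  "'a::topological_space measure \<Rightarrow> 'a measure \<Rightarrow> ('a \<times> 'a) measure set" where
  "transference_plans \<mu> \<nu> =
     {\<pi> \<in> space (prob_algebra borel). distr \<pi> borel fst = \<mu> \<and> distr \<pi> borel snd = \<nu>}"

definition transport_cost ::
  "('a \<times> 'a \<Rightarrow> real) \<Rightarrow> ('a \<times> 'a) measure \<Rightarrow> ennreal" where
  "transport_cost c \<pi> = (\<integral>\<^sup>+z. ennreal (c z) \<partial>\<pi>)"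

definition optimal_plans ::
  "('a::topological_space \<times> 'a \<Rightarrow> real) \<Rightarrow> 'a measure \<Rightarrow> 'a measure \<Rightarrow> ('a \<times> 'a) measure set" where
  "optimal_plans c \<mu> \<nu> =
     {\<pi> \<in> transference_plans \<mu> \<nu>. transport_cost c \<pi> < \<infinity> \<and>
        (\<forall>\<pi>' \<in> transference_plans \<mu> \<nu>. transport_cost c \<pi> \<le> transport_cost c \<pi>')}"

definition induced_by_map ::
  "'a::topological_space measure \<Rightarrow> ('a \<times> 'a) measure \<Rightarrow> ('a \<Rightarrow> 'a) \<Rightarrow> bool" where
  "induced_by_map \<mu> \<pi> T \<longleftrightarrow>
     T \<in> borel \<rightarrow>\<^sub>M borel \<and> \<pi> = kernel_prod \<mu> (\<lambda>x. return borel (T x))"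

definition optimal_transport_map ::
  "('a::topological_space \<times> 'a \<Rightarrow> real) \<Rightarrow> 'a measure \<Rightarrow> 'a measure \<Rightarrow> ('a \<Rightarrow> 'a) \<Rightarrow> bool" where
  "optimal_transport_map c \<mu> \<nu> T \<longleftrightarrow> (\<exists>\<pi> \<in> optimal_plans c \<mu> \<nu>. induced_by_map \<mu> \<pi> T)"

definition assumption_H ::
  "((real ^ 'd) \<times> (real ^ 'd) \<Rightarrow> real) \<Rightarrow> (real ^ 'd) measure \<Rightarrow> (real ^ 'd) measure \<Rightarrow> bool" where
  "assumption_H c \<mu> \<nu> \<longleftrightarrow>
     (\<forall>A \<in> sets borel. hausdorff_dim A \<le> ennreal (real CARD('d) - 1) \<longrightarrow> emeasure \<mu> A = 0) \<and>
     (\<exists>\<pi>. optimal_plans c \<mu> \<nu> = {\<pi>} \<and>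
        (\<exists>T. induced_by_map \<mu> \<pi> T \<and>
           (\<forall>T'. induced_by_map \<mu> \<pi> T' \<longrightarrow> (AE x in \<mu>. T' x = T x))))"

end

theory Submission
  imports Defs
begin

text \<open>
  Write \<open>\<pi>\<^sub>l\<close> for the unique optimal plan between \<open>\<mu> l\<close> and \<open>\<nu> l\<close>. The theorem follows from two facts:
  \<open>l \<mapsto> \<pi>\<^sub>l\<close> is a measurable kernel, and a measurable kernel whose values are concentrated on graphs
  has a jointly measurable graph function.

  For the first fact, every point of a second countable space is coded by the sequence of bits that record its
  membership in the members of a countable base. A measure is determined by its values on the cells of
  such a code, so a plan becomes a point of the compact space \<open>[0,1]\<close> to the power of the (countably
  many) finite bit words. Being a coupling of \<open>\<mu>\<close> and \<open>\<nu>\<close> is a system of countably many linear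
  equations and inequalities, each involving finitely many coordinates, whose constants are the masses of
  cells under \<open>\<mu>\<close> and \<open>\<nu>\<close>. Conversely every solution comes from a plan
  (\<open>coupling_weights_realised\<close>): finitely additive weights on bit words always extend to a measure on bit
  sequences, and the marginals, being laws of codes of genuine points, force this measure to live
  on codes of pairs of points. For continuous \<open>c \<ge> 0\<close>
  the cost of a plan is the supremum of countably many linear functions of its
  weights (\<open>transport_cost_eq_SUP_cell_cost\<close>), so \<open>cost \<le> r\<close> is a closed condition as well. Projecting
  a closed set along a compact factor gives a closed set; therefore, for every cell \<open>A\<close>, the set of
  those data (cell masses of \<open>\<mu>\<close> and \<open>\<nu>\<close>, and a bound \<open>r\<close>) for which some plan has cost at most \<open>r\<close> and
  gives mass at most \<open>t\<close> to \<open>A\<close> is closed. With \<open>t = 1\<close> this makes the minimal cost \<open>V l\<close> measurable in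
  \<open>l\<close>; with \<open>r = V l\<close> and uniqueness of the minimiser it makes \<open>\<pi>\<^sub>l A\<close> measurable in \<open>l\<close>
  (\<open>measurable_unique_optimal_plan\<close>).

  For the second fact, let \<open>U\<close> be a base set. The measure \<open>A \<mapsto> \<integral> \<pi>\<^sub>l (A\<^sub>l \<times> U) M(dl)\<close> on the product is
  absolutely continuous with respect to \<open>M(dl) \<mu>\<^sub>l(dx)\<close>. Its Radon-Nikodym density is jointly measurable
  and, comparing integrals over rectangles, equals the indicator of \<open>T\<^sub>l(x) \<in> U\<close> for almost every \<open>l\<close>
  and \<open>\<mu>\<^sub>l\<close>-almost every \<open>x\<close>. These densities are the bits of the code of \<open>T\<^sub>l(x)\<close>, and decoding them
  gives the required map (\<open>jointly_measurable_transport_map\<close>).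
\<close>

section \<open>Cells of a bit code\<close>

definition cell :: "('a \<Rightarrow> nat \<Rightarrow> bool) \<Rightarrow> bool list \<Rightarrow> 'a set" where
  "cell \<beta> w = {x. map (\<beta> x) [0..<length w] = w}"

lemma in_cell_iff: "x \<in> cell \<beta> w \<longleftrightarrow> (\<forall>i<length w. \<beta> x i = w ! i)"
  unfolding cell_def mem_Collect_eq by (subst list_eq_iff_nth_eq) simp

lemma in_cell_self: "x \<in> cell \<beta> (map (\<beta> x) [0..<n])"
  by (simp add: in_cell_iff)

lemma in_cell_same_length: "x \<in> cell \<beta> w \<Longrightarrow> x \<in> cell \<beta> v \<Longrightarrow> length v = length w \<Longrightarrow> v = w"
  by (simp add: cell_def)

lemma cell_Nil [simp]: "cell \<beta> [] = UNIV"
  by (simp add: cell_def)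

lemma cell_snoc: "cell \<beta> (w @ [b]) = {x \<in> cell \<beta> w. \<beta> x (length w) = b}"
  by (auto simp: in_cell_iff nth_append less_Suc_eq)

lemma finite_words [simp]: "finite {w :: bool list. length w = n \<and> P w}"
  by (rule finite_subset[OF _ finite_lists_length_eq[of "UNIV :: bool set" n]]) auto

lemma coordinate_eq_Union_cells:
  "{x. \<beta> x i} = (\<Union>w\<in>{w. length w = Suc i \<and> w ! i}. cell \<beta> w)"
proof (intro set_eqI iffI)
  fix x assume "x \<in> {x. \<beta> x i}"
  then show "x \<in> (\<Union>w\<in>{w. length w = Suc i \<and> w ! i}. cell \<beta> w)"
    by (intro UN_I[of "map (\<beta> x) [0..<Suc i]"]) (simp_all add: in_cell_iff del: upt_Suc)
qed (auto simp: in_cell_iff)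

lemma Int_stable_cells: "Int_stable (insert {} (range (cell \<beta>)))"
proof -
  have cases: "cell \<beta> v \<inter> cell \<beta> w \<in> insert {} (range (cell \<beta>))" if le: "length v \<le> length w" for v w
  proof (cases "take (length v) w = v")
    case True
    then have "w ! i = v ! i" if "i < length v" for i
      using that by (metis nth_take True)
    then have "cell \<beta> v \<inter> cell \<beta> w = cell \<beta> w"
      using le by (auto simp: in_cell_iff)
    then show ?thesis by auto
  next
    case False
    then obtain i where "i < length v" "w ! i \<noteq> v ! i"
      using le nth_equalityI[of "take (length v) w" v] by auto
    then have "cell \<beta> v \<inter> cell \<beta> w = {}"
      using le by (auto simp: in_cell_iff)
    then show ?thesis by simp
  qed
  show ?thesis
    unfolding Int_stable_def
  proof (intro ballI)
    fix A B assume A: "A \<in> insert {} (range (cell \<beta>))" and B: "B \<in> insert {} (range (cell \<beta>))"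
    show "A \<inter> B \<in> insert {} (range (cell \<beta>))"
    proof (cases "A = {} \<or> B = {}")
      case False
      then obtain v w where vw: "A = cell \<beta> v" "B = cell \<beta> w"
        using A B by auto
      show ?thesis
        using cases[of v w] cases[of w v] unfolding vw by (metis Int_commute linear)
    qed auto
  qed
qed

lemma sigma_sets_cells_idem:
  "sigma_sets UNIV (insert {} (range (cell \<beta>))) = sigma_sets UNIV (range (cell \<beta>))"
  by (rule sigma_sets_eqI) (auto intro: sigma_sets.intros)

text \<open>
  Cells of two words are nested or disjoint, so together with the empty set they form a generator
  closed under intersection.
\<close>

lemma measure_eq_if_eq_on_cells:
  assumes N: "sets N = sigma_sets UNIV (range (cell \<beta>))" and N': "sets N' = sets N"
    and fin: "finite_measure N"
    and eq: "\<And>w. emeasure N (cell \<beta> w) = emeasure N' (cell \<beta> w)"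
  shows "N = N'"
proof (rule measure_eqI_generator_eq[where E="insert {} (range (cell \<beta>))" and \<Omega>=UNIV and A="\<lambda>_. UNIV"])
  show "sets N = sigma_sets UNIV (insert {} (range (cell \<beta>)))"
    "sets N' = sigma_sets UNIV (insert {} (range (cell \<beta>)))"
    by (simp_all add: sigma_sets_cells_idem N N')
  show "range (\<lambda>_::nat. UNIV) \<subseteq> insert {} (range (cell \<beta>))"
    by (auto intro!: image_eqI[of _ _ "[]"])
qed (auto intro!: Int_stable_cells simp: eq finite_measure.emeasure_finite[OF fin])

abbreviation bit_sequences :: "(nat \<Rightarrow> bool) measure" where
  "bit_sequences \<equiv> PiM UNIV (\<lambda>_. count_space UNIV)"

lemma sets_bit_sequences: "sets bit_sequences = sigma_sets UNIV (range (cell (\<lambda>z. z)))"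
proof -
  let ?S = "sigma UNIV (range (cell (\<lambda>z :: nat \<Rightarrow> bool. z)))"
  have S: "sets ?S = sigma_sets UNIV (range (cell (\<lambda>z. z)))" by simp
  have "(\<lambda>z. z) \<in> ?S \<rightarrow>\<^sub>M bit_sequences"
  proof (rule measurable_PiM_single')
    fix i
    have "{z. z i} \<in> sets ?S"
      unfolding coordinate_eq_Union_cells[of "\<lambda>z. z" i]
      by (intro sets.finite_UN) auto
    then show "(\<lambda>z. z i) \<in> ?S \<rightarrow>\<^sub>M count_space UNIV"
      by (auto simp: pred_def space_measure_of_conv)
  qed (auto simp: space_measure_of_conv)
  then have 1: "sets bit_sequences \<subseteq> sets ?S"
    by (auto dest!: measurable_sets simp: space_measure_of_conv space_PiM)
  have "cell (\<lambda>z. z) w \<in> sets bit_sequences" for w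
  proof -
    have "cell (\<lambda>z. z) w = {z \<in> space bit_sequences. \<forall>i<length w. z i = w ! i}"
      by (auto simp: in_cell_iff space_PiM)
    also have "\<dots> \<in> sets bit_sequences" by measurable
    finally show ?thesis .
  qed
  then have "sets ?S \<subseteq> sets bit_sequences"
    unfolding S using sets.sigma_sets_subset[of "range (cell (\<lambda>z. z))" bit_sequences]
    by (auto simp: space_PiM)
  with 1 S show ?thesis by auto
qed

section \<open>Measures on bit sequences with prescribed cell masses\<close>

definition splitting_weights :: "(bool list \<Rightarrow> real) \<Rightarrow> bool" where
  "splitting_weights p \<longleftrightarrow>
     p [] = 1 \<and> (\<forall>w. 0 \<le> p w) \<and> (\<forall>w. p w = p (w @ [False]) + p (w @ [True]))"

text \<open>
  The weights of all words of a fixed length add up to 1, so the unit interval can be cut, from left to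
  right in the order of the words, into intervals of these lengths; longer words refine the
  subdivision. The left end point of the interval of a word is the total weight of the words of the same length
  preceding it, and a point \<open>u\<close> descends through the intervals containing it.
\<close>

definition left_end :: "(bool list \<Rightarrow> real) \<Rightarrow> bool list \<Rightarrow> real" where
  "left_end p w = (\<Sum>i<length w. if w ! i then p (take i w @ [False]) else 0)"

primrec descent :: "(bool list \<Rightarrow> real) \<Rightarrow> real \<Rightarrow> nat \<Rightarrow> bool list" where
  "descent p u 0 = []"
| "descent p u (Suc n) =
     descent p u n @ [left_end p (descent p u n) + p (descent p u n @ [False]) \<le> u]"

lemma splitting_weightsD:
  assumes "splitting_weights p"
  shows "p [] = 1" "0 \<le> p w" "p w = p (w @ [False]) + p (w @ [True])"
  using assms unfolding splitting_weights_def by blast+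

lemma length_descent [simp]: "length (descent p u n) = n"
  by (induction n) auto

lemma left_end_snoc:
  "left_end p (w @ [b]) = left_end p w + (if b then p (w @ [False]) else 0)"
  by (auto simp: left_end_def nth_append intro!: sum.cong)

lemma descent_eq_iff:
  assumes p: "splitting_weights p" and u: "0 \<le> u" "u < 1" and w: "length w = n"
  shows "descent p u n = w \<longleftrightarrow> left_end p w \<le> u \<and> u < left_end p w + p w"
  using w
proof (induction n arbitrary: w)
  case 0
  then show ?case
    using u by (simp add: splitting_weightsD(1)[OF p] left_end_def)
next
  case (Suc n)
  then obtain v b where w: "w = v @ [b]" and v: "length v = n"
    by (metis length_Suc_conv_rev)
  have *: "0 \<le> p (v @ [False])" "0 \<le> p (v @ [True])" "p v = p (v @ [False]) + p (v @ [True])"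
    using splitting_weightsD[OF p] by blast+
  have "descent p u (Suc n) = w \<longleftrightarrow>
     descent p u n = v \<and> (left_end p v + p (v @ [False]) \<le> u) = b"
    by (auto simp: w)
  also have "\<dots> \<longleftrightarrow> left_end p w \<le> u \<and> u < left_end p w + p w"
    unfolding Suc.IH[OF v] using * by (cases b) (auto simp: w left_end_snoc)
  finally show ?case .
qed

text \<open>
  The required measure is the law, under a uniformly distributed \<open>u\<close>, of the infinite word whose nested
  intervals contain \<open>u\<close>: the probability of descending into the interval of a word is its length.
\<close>

lemma bit_sequence_measure_exists:
  assumes p: "splitting_weights p"
  obtains P where "P \<in> space (prob_algebra bit_sequences)"
    "\<And>w. measure P (cell (\<lambda>z. z) w) = p w"
proof -
  define U where "U = uniform_measure lborel {0..<1::real}"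
  define Z where "Z u i = descent p u (Suc i) ! i" for u i
  have U: "prob_space U"
    unfolding U_def by (rule prob_space_uniform_measure) auto
  have sets_U [measurable_cong]: "sets U = sets borel" by (simp add: U_def)
  have take: "take m (descent p u n) = descent p u m" if "m \<le> n" for u m n
    using that by (induction n) (auto simp: le_Suc_eq)
  have Z: "map (Z u) [0..<n] = descent p u n" for u n
  proof (rule nth_equalityI)
    fix i assume "i < length (map (Z u) [0..<n])"
    then have i: "i < n" by simp
    then show "map (Z u) [0..<n] ! i = descent p u n ! i"
      using nth_take[of i "Suc i" "descent p u n"] take[of "Suc i" n u]
      by (simp add: Z_def del: descent.simps)
  qed simp
  have meas: "(\<lambda>u. descent p u n) \<in> borel \<rightarrow>\<^sub>M count_space UNIV" for n
  proof (induction n)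
    case (Suc n)
    have 1: "(\<lambda>u. f (descent p u n)) \<in> borel \<rightarrow>\<^sub>M borel" for f :: "_ \<Rightarrow> real"
      by (rule measurable_compose[OF Suc]) simp
    have 2: "Measurable.pred borel (\<lambda>u. left_end p (descent p u n) + p (descent p u n @ [False]) \<le> u)"
      using 1[of "\<lambda>w. left_end p w + p (w @ [False])"] by measurable
    have "(\<lambda>u. case (descent p u n, left_end p (descent p u n) + p (descent p u n @ [False]) \<le> u)
         of (w, b) \<Rightarrow> w @ [b]) \<in> borel \<rightarrow>\<^sub>M count_space UNIV"
      by (rule measurable_compose[OF measurable_Pair[OF Suc 2]]) (simp add: pair_measure_countable)
    then show ?case by simp
  qed simp
  have [measurable]: "Z \<in> borel \<rightarrow>\<^sub>M bit_sequences"
  proof (rule measurable_PiM_single')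
    fix i show "(\<lambda>u. Z u i) \<in> borel \<rightarrow>\<^sub>M count_space UNIV"
      unfolding Z_def by (rule measurable_compose[OF meas]) auto
  qed (auto)
  show ?thesis
  proof (rule that[of "distr U bit_sequences Z"])
    show "distr U bit_sequences Z \<in> space (prob_algebra bit_sequences)"
      by (simp add: space_prob_algebra prob_space.prob_space_distr[OF U])
    fix w
    have nn: "0 \<le> p w" by (rule splitting_weightsD[OF p])
    have "measure (distr U bit_sequences Z) (cell (\<lambda>z. z) w) = measure U (Z -` cell (\<lambda>z. z) w)"
      using sets_eq_imp_space_eq[OF sets_U] sigma_sets.Basic[of "cell (\<lambda>z. z) w" "range (cell (\<lambda>z. z))" UNIV]
      by (subst measure_distr) (simp_all add: sets_bit_sequences)
    also have "Z -` cell (\<lambda>z. z) w = {u. descent p u (length w) = w}"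
      by (simp add: cell_def Z vimage_def)
    also have "measure U \<dots> = measure lborel ({0..<1} \<inter> {u. descent p u (length w) = w})"
      using measurable_sets[OF meas, of "{w}" "length w"]
      unfolding U_def by (subst measure_uniform_measure) (simp_all add: vimage_def)
    also have "{0..<1} \<inter> {u. descent p u (length w) = w} = {left_end p w..<left_end p w + p w}"
    proof -
      have "0 \<le> left_end p w" "left_end p w + p w \<le> 1"
      proof (induction w rule: rev_induct)
        case Nil
        { case 1 show ?case by (simp add: left_end_def) }
        { case 2 show ?case by (simp add: left_end_def splitting_weightsD(1)[OF p]) }
      next
        case (snoc b w)
        have *: "0 \<le> p (w @ [False])" "0 \<le> p (w @ [True])" "p w = p (w @ [False]) + p (w @ [True])"
          using splitting_weightsD[OF p] by blast+
        { case 1 show ?case using snoc * by (simp add: left_end_snoc) }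
        { case 2 show ?case using snoc * by (cases b) (simp_all add: left_end_snoc) }
      qed
      then show ?thesis
        by (auto simp: descent_eq_iff[OF p _ _ refl, of _ w])
    qed
    also have "measure lborel \<dots> = p w" using nn by simp
    finally show "measure (distr U bit_sequences Z) (cell (\<lambda>z. z) w) = p w" .
  qed
qed

section \<open>Coding the points of a second countable space\<close>

text \<open>
  Each neighbourhood of a point contains a cell around the point. The cells are Borel, but a cell need
  not be a neighbourhood of its points.
\<close>

definition fine_code :: "('a::topological_space \<Rightarrow> nat \<Rightarrow> bool) \<Rightarrow> bool" where
  "fine_code \<beta> \<longleftrightarrow> (\<forall>i. {x. \<beta> x i} \<in> sets borel) \<and>
     (\<forall>S x. open S \<and> x \<in> S \<longrightarrow> (\<exists>n. cell \<beta> (map (\<beta> x) [0..<n]) \<subseteq> S))"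

lemma fine_code_pred: "fine_code \<beta> \<Longrightarrow> Measurable.pred borel (\<lambda>x. \<beta> x i)"
  by (auto simp: fine_code_def pred_def)

lemma fine_codeE:
  assumes "fine_code \<beta>" "open S" "x \<in> S"
  obtains n where "\<And>y. (\<And>i. i < n \<Longrightarrow> \<beta> y i = \<beta> x i) \<Longrightarrow> y \<in> S"
proof -
  obtain n where "cell \<beta> (map (\<beta> x) [0..<n]) \<subseteq> S"
    using assms unfolding fine_code_def by blast
  then show ?thesis
    by (intro that[of n]) (auto simp: in_cell_iff subset_eq)
qed

text \<open>
  The bits record membership in the members of a countable base.
\<close>

lemma fine_code_exists: "\<exists>\<beta> :: 'a::second_countable_topology \<Rightarrow> nat \<Rightarrow> bool. fine_code \<beta>"
proof -
  obtain B :: "'a set set" where B: "countable B" "topological_basis B"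
    using ex_countable_basis by blast
  have "B \<noteq> {}"
    using topological_basisE[OF B(2) open_UNIV UNIV_I] by blast
  then obtain U :: "nat \<Rightarrow> 'a set" where U: "B = range U"
    using range_from_nat_into[of B] B(1) by metis
  have "fine_code (\<lambda>x i. x \<in> U i)"
    unfolding fine_code_def
  proof (intro conjI allI impI)
    fix i show "{x. x \<in> U i} \<in> sets borel"
      using topological_basis_open[OF B(2)] by (auto simp: U)
  next
    fix S :: "'a set" and x assume "open S \<and> x \<in> S"
    then obtain i where i: "x \<in> U i" "U i \<subseteq> S"
      using topological_basisE[OF B(2), of S x] unfolding U by blast
    then have "cell (\<lambda>x i. x \<in> U i) (map (\<lambda>i. x \<in> U i) [0..<Suc i]) \<subseteq> S"
      by (auto simp: in_cell_iff less_Suc_eq nth_append)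
    then show "\<exists>n. cell (\<lambda>x i. x \<in> U i) (map (\<lambda>i. x \<in> U i) [0..<n]) \<subseteq> S" ..
  qed
  then show ?thesis by (rule exI[of fine_code])
qed

lemma sets_borel_eq_cells:
  fixes \<beta> :: "'a::topological_space \<Rightarrow> nat \<Rightarrow> bool"
  assumes \<beta>: "fine_code \<beta>"
  shows "sets borel = sigma_sets UNIV (range (cell \<beta>))"
proof
  note fine_code_pred[OF \<beta>, measurable]
  have "cell \<beta> w \<in> sets borel" for w
  proof -
    have "cell \<beta> w = {x \<in> space borel. \<forall>i<length w. \<beta> x i = w ! i}"
      by (auto simp: in_cell_iff)
    also have "\<dots> \<in> sets borel" by measurable
    finally show ?thesis .
  qed
  then show "sigma_sets UNIV (range (cell \<beta>)) \<subseteq> sets borel"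
    using sets.sigma_sets_subset[of "range (cell \<beta>)" borel] by auto
  have "S \<in> sigma_sets UNIV (range (cell \<beta>))" if "open S" for S
  proof -
    have "S = (\<Union>w\<in>{w. cell \<beta> w \<subseteq> S}. cell \<beta> w)"
      using \<beta> that in_cell_self[of _ \<beta>] unfolding fine_code_def by blast
    also have "\<dots> \<in> sets (sigma UNIV (range (cell \<beta>)))"
      by (intro sets.countable_UN') auto
    finally show ?thesis by simp
  qed
  then show "sets borel \<subseteq> sigma_sets UNIV (range (cell \<beta>))"
    unfolding borel_def by (auto simp: sets_measure_of intro!: sigma_sets_mono)
qed

lemma cell_borel: "fine_code \<beta> \<Longrightarrow> cell \<beta> w \<in> sets borel"
  by (simp add: sets_borel_eq_cells)

text \<open>
  Cells of increasing prefixes of the code of \<open>x\<close> shrink to \<open>x\<close>, so \<open>x\<close> is the limit of arbitrarily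
  chosen points of these cells. The chosen point depends on a finite word only, hence measurably on the
  sequence, and the limit is measurable on all bit sequences, codes or not.
\<close>

lemma fine_code_decode:
  fixes \<beta> :: "'a::{banach, second_countable_topology} \<Rightarrow> nat \<Rightarrow> bool"
  assumes \<beta>: "fine_code \<beta>"
  obtains g where "g \<in> bit_sequences \<rightarrow>\<^sub>M borel" "\<And>x. g (\<beta> x) = x"
proof -
  define q where "q w = (SOME x. x \<in> cell \<beta> w)" for w
  have q: "q w \<in> cell \<beta> w" if "x \<in> cell \<beta> w" for x w
    unfolding q_def using that by (rule someI)
  define g where "g z = lim (\<lambda>n. q (map z [0..<n]))" for z
  have "(\<lambda>z. map z [0..<n]) \<in> bit_sequences \<rightarrow>\<^sub>M count_space UNIV" for n
  proof (rule measurable_count_space_eq2_countable[THEN iffD2], intro conjI ballI)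
    fix w
    have "(\<lambda>z. map z [0..<n]) -` {w} \<inter> space bit_sequences =
        (if length w = n then cell (\<lambda>z. z) w else {})"
      by (auto simp: cell_def space_PiM)
    also have "\<dots> \<in> sets bit_sequences"
      using sets.empty_sets[of bit_sequences] by (simp add: sets_bit_sequences)
    finally show "(\<lambda>z. map z [0..<n]) -` {w} \<inter> space bit_sequences \<in> sets bit_sequences" .
  qed auto
  then have "(\<lambda>z. q (map z [0..<n])) \<in> bit_sequences \<rightarrow>\<^sub>M borel" for n
    by (rule measurable_compose) simp
  then have "g \<in> bit_sequences \<rightarrow>\<^sub>M borel"
    unfolding g_def by (rule borel_measurable_lim_metric)
  moreover have "g (\<beta> x) = x" for x
    unfolding g_def
  proof (intro limI topological_tendstoI)
    fix S :: "'a set" assume "open S" "x \<in> S"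
    then obtain n where n: "\<And>y. (\<And>i. i < n \<Longrightarrow> \<beta> y i = \<beta> x i) \<Longrightarrow> y \<in> S"
      using fine_codeE[OF \<beta>] by metis
    have "q (map (\<beta> x) [0..<k]) \<in> S" if "n \<le> k" for k
      using q[OF in_cell_self[of x \<beta> k]] that by (intro n) (auto simp: in_cell_iff)
    then show "\<forall>\<^sub>F k in sequentially. q (map (\<beta> x) [0..<k]) \<in> S"
      by (auto simp: eventually_sequentially)
  qed
  ultimately show ?thesis by (rule that)
qed

section \<open>Couplings as weights on bit words\<close>

definition pair_code :: "('a \<Rightarrow> nat \<Rightarrow> bool) \<Rightarrow> 'a \<times> 'a \<Rightarrow> nat \<Rightarrow> bool" where
  "pair_code \<beta> z i = \<beta> (if even i then fst z else snd z) (i div 2)"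

lemma pair_code_even [simp]: "pair_code \<beta> z (2 * i) = \<beta> (fst z) i"
  and pair_code_odd [simp]: "pair_code \<beta> z (Suc (2 * i)) = \<beta> (snd z) i"
  by (simp_all add: pair_code_def)

lemma fine_code_pair:
  fixes \<beta> :: "'a::second_countable_topology \<Rightarrow> nat \<Rightarrow> bool"
  assumes \<beta>: "fine_code \<beta>"
  shows "fine_code (pair_code \<beta>)"
  unfolding fine_code_def
proof (intro conjI allI impI)
  note fine_code_pred[OF \<beta>, measurable]
  fix i
  have "{z \<in> space (borel \<Otimes>\<^sub>M borel). pair_code \<beta> z i} \<in> sets (borel \<Otimes>\<^sub>M borel)"
    unfolding pair_code_def by (cases "even i") simp_all
  then show "{z. pair_code \<beta> z i} \<in> sets borel"
    by (simp add: borel_prod[symmetric] space_pair_measure)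
next
  fix S :: "('a \<times> 'a) set" and z assume "open S \<and> z \<in> S"
  then obtain A B where AB: "open A" "open B" "fst z \<in> A" "snd z \<in> B" "A \<times> B \<subseteq> S"
    by (metis open_prod_elim mem_Times_iff)
  obtain m where m: "\<And>y. (\<And>i. i < m \<Longrightarrow> \<beta> y i = \<beta> (fst z) i) \<Longrightarrow> y \<in> A"
    using fine_codeE[OF \<beta> AB(1,3)] by metis
  obtain n where n: "\<And>y. (\<And>i. i < n \<Longrightarrow> \<beta> y i = \<beta> (snd z) i) \<Longrightarrow> y \<in> B"
    using fine_codeE[OF \<beta> AB(2,4)] by metis
  have "cell (pair_code \<beta>) (map (pair_code \<beta> z) [0..<2 * (m + n)]) \<subseteq> A \<times> B"
  proof
    fix y assume "y \<in> cell (pair_code \<beta>) (map (pair_code \<beta> z) [0..<2 * (m + n)])"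
    then have y: "pair_code \<beta> y i = pair_code \<beta> z i" if "i < 2 * (m + n)" for i
      using that by (auto simp: in_cell_iff)
    have "fst y \<in> A"
      using y[of "2 * i" for i] by (intro m) simp
    moreover have "snd y \<in> B"
      using y[of "Suc (2 * i)" for i] by (intro n) simp
    ultimately show "y \<in> A \<times> B" by (simp add: mem_Times_iff)
  qed
  then show "\<exists>n. cell (pair_code \<beta>) (map (pair_code \<beta> z) [0..<n]) \<subseteq> S"
    using AB(5) by blast
qed

text \<open>
  In a code of a pair the bits of the first point have even indices and those of the second point odd
  ones. Summing the weights of these words, with \<open>k = 0\<close> or \<open>k = 1\<close>, gives the mass of the cell of \<open>v\<close>
  under the first or the second marginal.
\<close>

definition interleavings :: "nat \<Rightarrow> bool list \<Rightarrow> bool list set" where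
  "interleavings k v = {w. length w = 2 * length v \<and> (\<forall>i<length v. w ! (2 * i + k) = v ! i)}"

lemma finite_interleavings [simp]: "finite (interleavings k v)"
  unfolding interleavings_def by simp

lemma cell_subcode:
  assumes k: "k < 2"
  shows "cell (\<lambda>x i. \<gamma> x (2 * i + k)) v = (\<Union>w\<in>interleavings k v. cell \<gamma> w)"
proof (intro set_eqI iffI)
  fix x assume "x \<in> cell (\<lambda>x i. \<gamma> x (2 * i + k)) v"
  then show "x \<in> (\<Union>w\<in>interleavings k v. cell \<gamma> w)"
    using k by (intro UN_I[of "map (\<gamma> x) [0..<2 * length v]"])
      (auto simp: in_cell_iff interleavings_def)
qed (use k in \<open>auto simp: in_cell_iff interleavings_def\<close>)

lemma measure_cell_subcode:
  assumes k: "k < 2" and N: "finite_measure N" and sets: "\<And>w. cell \<gamma> w \<in> sets N"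
  shows "measure N (cell (\<lambda>x i. \<gamma> x (2 * i + k)) v) = (\<Sum>w\<in>interleavings k v. measure N (cell \<gamma> w))"
  unfolding cell_subcode[OF k]
proof (rule finite_measure.finite_measure_finite_Union[OF N])
  show "disjoint_family_on (cell \<gamma>) (interleavings k v)"
    by (auto simp: disjoint_family_on_def interleavings_def dest: in_cell_same_length)
qed (use sets in auto)

text \<open>
  The functions \<open>a\<close> and \<open>b\<close> stand for the cell masses of the two marginals. Every condition relates only
  finitely many values of \<open>p\<close>, \<open>a\<close> and \<open>b\<close>, so together they describe a closed set of triples.
\<close>

definition coupling_weights ::
  "(bool list \<Rightarrow> real) \<Rightarrow> (bool list \<Rightarrow> real) \<Rightarrow> (bool list \<Rightarrow> real) \<Rightarrow> bool" where
  "coupling_weights a b p \<longleftrightarrow> splitting_weights p \<and>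
     (\<forall>v. (\<Sum>w\<in>interleavings 0 v. p w) = a v) \<and> (\<forall>v. (\<Sum>w\<in>interleavings 1 v. p w) = b v)"

lemma transference_planD:
  fixes \<pi> :: "('a::second_countable_topology \<times> 'a) measure"
  assumes \<pi>: "\<pi> \<in> transference_plans \<mu> \<nu>"
  shows "prob_space \<pi>" "sets \<pi> = sets borel" "fst \<in> \<pi> \<rightarrow>\<^sub>M borel" "snd \<in> \<pi> \<rightarrow>\<^sub>M borel"
    "distr \<pi> borel fst = \<mu>" "distr \<pi> borel snd = \<nu>" "space \<pi> = UNIV"
proof -
  show *: "prob_space \<pi>" "sets \<pi> = sets borel" "distr \<pi> borel fst = \<mu>" "distr \<pi> borel snd = \<nu>"
    using \<pi> by (auto simp: transference_plans_def space_prob_algebra)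
  show "space \<pi> = UNIV" using sets_eq_imp_space_eq[OF *(2)] by simp
  have "fst \<in> borel \<Otimes>\<^sub>M (borel :: 'a measure) \<rightarrow>\<^sub>M (borel :: 'a measure)"
    "snd \<in> (borel :: 'a measure) \<Otimes>\<^sub>M borel \<rightarrow>\<^sub>M (borel :: 'a measure)"
    by simp_all
  then show "fst \<in> \<pi> \<rightarrow>\<^sub>M borel" "snd \<in> \<pi> \<rightarrow>\<^sub>M borel"
    unfolding measurable_cong_sets[OF *(2) refl] borel_prod .
qed

lemma transference_plan_weights:
  fixes \<beta> :: "'a::second_countable_topology \<Rightarrow> nat \<Rightarrow> bool"
  assumes \<beta>: "fine_code \<beta>" and \<pi>: "\<pi> \<in> transference_plans \<mu> \<nu>"
  shows "coupling_weights (\<lambda>v. measure \<mu> (cell \<beta> v)) (\<lambda>v. measure \<nu> (cell \<beta> v))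
           (\<lambda>w. measure \<pi> (cell (pair_code \<beta>) w))"
proof -
  note \<pi>' = transference_planD[OF \<pi>]
  interpret \<pi>: prob_space \<pi> by (rule \<pi>')
  have sets: "cell (pair_code \<beta>) w \<in> sets \<pi>" for w
    unfolding \<pi>'(2) by (rule cell_borel[OF fine_code_pair[OF \<beta>]])
  have split: "measure \<pi> (cell (pair_code \<beta>) w) =
      measure \<pi> (cell (pair_code \<beta>) (w @ [False])) + measure \<pi> (cell (pair_code \<beta>) (w @ [True]))" for w
    using sets[of "w @ [False]"] sets[of "w @ [True]"]
    by (subst \<pi>.finite_measure_Union[symmetric])
       (auto simp: cell_snoc intro!: arg_cong[of _ _ "measure \<pi>"])
  have "splitting_weights (\<lambda>w. measure \<pi> (cell (pair_code \<beta>) w))"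
    unfolding splitting_weights_def
  proof (intro conjI allI)
    show "measure \<pi> (cell (pair_code \<beta>) []) = 1"
      using \<pi>.prob_space by (simp add: \<pi>')
  qed (rule measure_nonneg, rule split)
  moreover have "(\<Sum>w\<in>interleavings 0 v. measure \<pi> (cell (pair_code \<beta>) w)) = measure \<mu> (cell \<beta> v)" for v
  proof -
    have "(\<Sum>w\<in>interleavings 0 v. measure \<pi> (cell (pair_code \<beta>) w)) =
        measure \<pi> (cell (\<lambda>z i. pair_code \<beta> z (2 * i + 0)) v)"
      by (rule measure_cell_subcode[symmetric]) (use sets in auto, unfold_locales)
    also have "cell (\<lambda>z i. pair_code \<beta> z (2 * i + 0)) v = fst -` cell \<beta> v \<inter> space \<pi>"
      by (auto simp: in_cell_iff \<pi>')
    finally show ?thesis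
      using \<pi>' cell_borel[OF \<beta>] by (metis measure_distr)
  qed
  moreover have "(\<Sum>w\<in>interleavings 1 v. measure \<pi> (cell (pair_code \<beta>) w)) = measure \<nu> (cell \<beta> v)" for v
  proof -
    have "(\<Sum>w\<in>interleavings 1 v. measure \<pi> (cell (pair_code \<beta>) w)) =
        measure \<pi> (cell (\<lambda>z i. pair_code \<beta> z (2 * i + 1)) v)"
      by (rule measure_cell_subcode[symmetric]) (use sets in auto, unfold_locales)
    also have "cell (\<lambda>z i. pair_code \<beta> z (2 * i + 1)) v = snd -` cell \<beta> v \<inter> space \<pi>"
      by (auto simp: in_cell_iff \<pi>')
    finally show ?thesis
      using \<pi>' cell_borel[OF \<beta>] by (metis measure_distr)
  qed
  ultimately show ?thesis
    by (simp add: coupling_weights_def)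
qed

text \<open>
  The weights define a law on interleaved pairs of bit sequences. Its two components have the laws of
  the codes of \<open>\<mu>\<close>- and \<open>\<nu>\<close>-distributed points, because they agree with these on cells. Hence each
  component almost surely is the code of a point, and decoding both gives the plan: no mass escapes to
  sequences that code nothing, although the weights are only assumed to be finitely additive.
\<close>

lemma coupling_weights_realised:
  fixes \<beta> :: "'a::{banach, second_countable_topology} \<Rightarrow> nat \<Rightarrow> bool"
  assumes \<beta>: "fine_code \<beta>"
    and \<mu>: "\<mu> \<in> space (prob_algebra borel)" and \<nu>: "\<nu> \<in> space (prob_algebra borel)"
    and p: "coupling_weights (\<lambda>v. measure \<mu> (cell \<beta> v)) (\<lambda>v. measure \<nu> (cell \<beta> v)) p"
  obtains \<pi> where "\<pi> \<in> transference_plans \<mu> \<nu>" "\<And>w. measure \<pi> (cell (pair_code \<beta>) w) = p w"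
proof -
  obtain P where P: "P \<in> space (prob_algebra bit_sequences)" and Pp: "\<And>w. measure P (cell (\<lambda>z. z) w) = p w"
    using bit_sequence_measure_exists[of p] p unfolding coupling_weights_def by metis
  obtain g where g[measurable]: "g \<in> bit_sequences \<rightarrow>\<^sub>M borel" and g\<beta>: "\<And>x. g (\<beta> x) = x"
    using fine_code_decode[OF \<beta>] by metis
  note fine_code_pred[OF \<beta>, measurable]
  have sP[measurable_cong]: "sets P = sets bit_sequences" using P by (simp add: space_prob_algebra)
  have space_P: "space P = UNIV" using sets_eq_imp_space_eq[OF sP] by (simp add: space_PiM)
  interpret P: prob_space P using P by (simp add: space_prob_algebra)
  define part :: "nat \<Rightarrow> (nat \<Rightarrow> bool) \<Rightarrow> nat \<Rightarrow> bool" where "part k z i = z (2 * i + k)" for k z i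
  have [measurable]: "part k \<in> bit_sequences \<rightarrow>\<^sub>M bit_sequences" for k
    unfolding part_def by (rule measurable_PiM_single') auto
  have \<beta>_meas[measurable]: "\<beta> \<in> borel \<rightarrow>\<^sub>M bit_sequences"
    by (rule measurable_PiM_single') auto
  have law: "distr P bit_sequences (part k) = distr \<rho> bit_sequences \<beta>"
    if k: "k < 2" and \<rho>: "\<rho> \<in> space (prob_algebra borel)"
      and sum: "\<And>v. (\<Sum>w\<in>interleavings k v. p w) = measure \<rho> (cell \<beta> v)" for k \<rho>
  proof (rule measure_eq_if_eq_on_cells[OF _ _ prob_space.finite_measure])
    interpret \<rho>: prob_space \<rho> using \<rho> by (simp add: space_prob_algebra)
    have s\<rho>[measurable_cong]: "sets \<rho> = sets borel" using \<rho> by (simp add: space_prob_algebra)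
    have space_\<rho>: "space \<rho> = UNIV" using sets_eq_imp_space_eq[OF s\<rho>] by simp
    show "prob_space (distr P bit_sequences (part k))"
      by (rule P.prob_space_distr) simp
    fix w
    have bs: "cell (\<lambda>z. z) w \<in> sets bit_sequences" for w by (simp add: sets_bit_sequences)
    have "measure (distr P bit_sequences (part k)) (cell (\<lambda>z. z) w) = measure P (cell (\<lambda>z i. z (2 * i + k)) w)"
      using bs by (subst measure_distr) (auto simp: part_def in_cell_iff space_P intro!: arg_cong[of _ _ "measure P"])
    also have "\<dots> = measure \<rho> (cell \<beta> w)"
      using bs by (subst measure_cell_subcode[OF k]) (auto simp: Pp sum sP intro: P.finite_measure_axioms)
    also have "\<dots> = measure (distr \<rho> bit_sequences \<beta>) (cell (\<lambda>z. z) w)"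
      using bs by (subst measure_distr) (auto simp: in_cell_iff space_\<rho> intro!: arg_cong[of _ _ "measure \<rho>"])
    finally show "emeasure (distr P bit_sequences (part k)) (cell (\<lambda>z. z) w) =
        emeasure (distr \<rho> bit_sequences \<beta>) (cell (\<lambda>z. z) w)"
      by (simp add: finite_measure.emeasure_eq_measure prob_space.finite_measure P.prob_space_distr \<rho>.prob_space_distr)
  qed (auto simp: sets_bit_sequences)
  have marginal: "distr P borel (\<lambda>z. g (part k z)) = \<rho>" "AE z in P. \<beta> (g (part k z)) = part k z"
    if k: "k < 2" and \<rho>: "\<rho> \<in> space (prob_algebra borel)"
      and sum: "\<And>v. (\<Sum>w\<in>interleavings k v. p w) = measure \<rho> (cell \<beta> v)" for k \<rho>
  proof -
    note law = law[OF k \<rho> sum]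
    have s\<rho>[measurable_cong]: "sets \<rho> = sets borel" using \<rho> by (simp add: space_prob_algebra)
    have "distr P borel (\<lambda>z. g (part k z)) = distr (distr P bit_sequences (part k)) borel g"
      by (subst distr_distr) (auto simp: comp_def)
    also have "\<dots> = distr \<rho> borel (\<lambda>x. g (\<beta> x))"
      unfolding law by (subst distr_distr) (auto simp: comp_def)
    also have "\<dots> = \<rho>"
      by (simp add: g\<beta>) (rule distr_id2[OF s\<rho>[symmetric]])
    finally show "distr P borel (\<lambda>z. g (part k z)) = \<rho>" .
    have pr: "{z \<in> space bit_sequences. \<beta> (g z) = z} \<in> sets bit_sequences"
      unfolding fun_eq_iff by measurable
    have "AE z in distr P bit_sequences (part k). \<beta> (g z) = z"
      unfolding law by (subst AE_distr_iff) (use pr in \<open>auto simp: g\<beta>\<close>)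
    then show "AE z in P. \<beta> (g (part k z)) = part k z"
      by (subst (asm) AE_distr_iff) (use pr in auto)
  qed
  define X where "X z = (g (part 0 z), g (part 1 z))" for z
  have X[measurable]: "X \<in> P \<rightarrow>\<^sub>M borel"
    unfolding X_def borel_prod[symmetric] by measurable
  have sums: "(\<Sum>w\<in>interleavings 0 v. p w) = measure \<mu> (cell \<beta> v)"
    "(\<Sum>w\<in>interleavings 1 v. p w) = measure \<nu> (cell \<beta> v)" for v
    using p by (auto simp: coupling_weights_def)
  have k: "0 < (2::nat)" "1 < (2::nat)" by simp_all
  have fst_snd: "fst \<in> (borel :: ('a \<times> 'a) measure) \<rightarrow>\<^sub>M borel"
    "snd \<in> (borel :: ('a \<times> 'a) measure) \<rightarrow>\<^sub>M borel"
    unfolding borel_prod[symmetric] by simp_all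
  show ?thesis
  proof (rule that[of "distr P borel X"])
    show "distr P borel X \<in> transference_plans \<mu> \<nu>"
      using marginal(1)[OF k(1) \<mu> sums(1)] marginal(1)[OF k(2) \<nu> sums(2)]
      by (auto simp: transference_plans_def space_prob_algebra P.prob_space_distr distr_distr[OF fst_snd(1)]
          distr_distr[OF fst_snd(2)] comp_def X_def)
    fix w
    have AE: "AE z in P. pair_code \<beta> (X z) = z"
      using marginal(2)[OF k(1) \<mu> sums(1)] marginal(2)[OF k(2) \<nu> sums(2)]
    proof eventually_elim
      case (elim z)
      have "pair_code \<beta> (X z) i = z i" for i
        by (cases "even i") (use elim in \<open>auto simp: fun_eq_iff X_def part_def elim!: evenE oddE\<close>)
      then show ?case ..
    qed
    have "measure (distr P borel X) (cell (pair_code \<beta>) w) = measure P (X -` cell (pair_code \<beta>) w \<inter> space P)"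
      by (rule measure_distr) (auto intro: cell_borel fine_code_pair \<beta>)
    also have "\<dots> = measure P (cell (\<lambda>z. z) w)"
    proof (rule P.finite_measure_eq_AE)
      show "AE z in P. (z \<in> X -` cell (pair_code \<beta>) w \<inter> space P) = (z \<in> cell (\<lambda>z. z) w)"
        using AE by eventually_elim (auto simp: in_cell_iff space_P)
      show "X -` cell (pair_code \<beta>) w \<inter> space P \<in> sets P"
        by (rule measurable_sets[OF X]) (auto intro: cell_borel fine_code_pair \<beta>)
    qed (simp add: sP sets_bit_sequences)
    finally show "measure (distr P borel X) (cell (pair_code \<beta>) w) = p w"
      by (simp add: Pp)
  qed
qed

section \<open>The transport cost as a supremum of linear functions of the weights\<close>

text \<open>
  The infimum of the empty set of reals is unspecified; the value \<open>0\<close> keeps \<open>cell_inf\<close> nonnegative on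
  empty cells, which carry no mass.
\<close>

definition cell_inf :: "('a \<Rightarrow> nat \<Rightarrow> bool) \<Rightarrow> ('a \<Rightarrow> real) \<Rightarrow> bool list \<Rightarrow> real" where
  "cell_inf \<gamma> c w = (if cell \<gamma> w = {} then 0 else Inf (c ` cell \<gamma> w))"

definition cell_cost :: "('a \<Rightarrow> nat \<Rightarrow> bool) \<Rightarrow> ('a \<Rightarrow> real) \<Rightarrow> nat \<Rightarrow> (bool list \<Rightarrow> real) \<Rightarrow> real" where
  "cell_cost \<gamma> c n p = (\<Sum>w | length w = n. cell_inf \<gamma> c w * p w)"

lemma finite_words_length [simp]: "finite {w :: bool list. length w = n}"
  using finite_words[of n "\<lambda>_. True"] by simp

lemma cell_inf_nonneg:
  assumes "\<And>z. 0 \<le> c z"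
  shows "0 \<le> cell_inf \<gamma> c w"
  unfolding cell_inf_def by (auto intro!: cInf_greatest assms)

lemma cell_inf_le:
  assumes "\<And>z. 0 \<le> c z" "x \<in> cell \<gamma> w"
  shows "cell_inf \<gamma> c w \<le> c x"
  unfolding cell_inf_def using assms by (auto intro!: cInf_lower bdd_belowI2[of _ 0])

lemma cell_inf_mono:
  assumes c: "\<And>z. 0 \<le> c z" and mn: "m \<le> n"
  shows "cell_inf \<gamma> c (map (\<gamma> x) [0..<m]) \<le> cell_inf \<gamma> c (map (\<gamma> x) [0..<n])"
proof -
  have *: "x \<in> cell \<gamma> (map (\<gamma> x) [0..<k])" for k by (rule in_cell_self)
  then have ne: "cell \<gamma> (map (\<gamma> x) [0..<k]) \<noteq> {}" for k by blast
  have "cell \<gamma> (map (\<gamma> x) [0..<n]) \<subseteq> cell \<gamma> (map (\<gamma> x) [0..<m])"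
    using mn by (auto simp: in_cell_iff)
  then show ?thesis
    using ne c unfolding cell_inf_def by (auto intro!: cInf_superset_mono bdd_belowI2[of _ 0])
qed

text \<open>
  This is where continuity of \<open>c\<close> enters: near \<open>x\<close> the cost exceeds any given number below \<open>c x\<close>, and a
  cell containing \<open>x\<close> fits into that neighbourhood.
\<close>

lemma cell_inf_tendsto:
  fixes \<gamma> :: "'a::topological_space \<Rightarrow> nat \<Rightarrow> bool"
  assumes \<gamma>: "fine_code \<gamma>" and c: "\<And>z. 0 \<le> c z" and cont: "continuous_on UNIV c"
  shows "(\<lambda>n. cell_inf \<gamma> c (map (\<gamma> x) [0..<n])) \<longlonglongrightarrow> c x"
proof (rule order_tendstoI)
  fix a assume "c x < a"
  then show "\<forall>\<^sub>F n in sequentially. cell_inf \<gamma> c (map (\<gamma> x) [0..<n]) < a"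
    using cell_inf_le[OF c in_cell_self] by (intro always_eventually allI) (rule le_less_trans)
next
  fix a assume "a < c x"
  then obtain b where b: "a < b" "b < c x" using dense by blast
  have "open {y. b < c y}"
    using cont by (intro open_Collect_less) auto
  then obtain n where n: "\<And>y. (\<And>i. i < n \<Longrightarrow> \<gamma> y i = \<gamma> x i) \<Longrightarrow> b < c y"
    using fine_codeE[OF \<gamma>, of "{y. b < c y}" x] b(2) by auto
  have "b \<le> cell_inf \<gamma> c (map (\<gamma> x) [0..<n])"
  proof -
    have "b \<le> c y" if "y \<in> cell \<gamma> (map (\<gamma> x) [0..<n])" for y
      using that by (intro less_imp_le n) (simp add: in_cell_iff)
    then show ?thesis
      using in_cell_self[of x \<gamma> n] unfolding cell_inf_def by (auto intro!: cInf_greatest)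
  qed
  then have "a < cell_inf \<gamma> c (map (\<gamma> x) [0..<k])" if "n \<le> k" for k
    using cell_inf_mono[where c=c and \<gamma>="\<gamma>" and x=x, OF c that] b(1) by linarith
  then show "\<forall>\<^sub>F n in sequentially. a < cell_inf \<gamma> c (map (\<gamma> x) [0..<n])"
    unfolding eventually_sequentially by blast
qed

text \<open>
  Monotone convergence: \<open>c\<close> is the increasing limit of the functions that are constant on the cells of
  words of length \<open>n\<close>, with the infimum of \<open>c\<close> over the cell as value.
\<close>

lemma transport_cost_eq_SUP_cell_cost:
  fixes \<gamma> :: "'a::topological_space \<times> 'a \<Rightarrow> nat \<Rightarrow> bool"
  assumes \<gamma>: "fine_code \<gamma>" and c: "\<And>z. 0 \<le> c z" and cont: "continuous_on UNIV c"
    and N: "finite_measure N" "sets N = sets borel"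
  shows "transport_cost c N = (SUP n. ennreal (cell_cost \<gamma> c n (\<lambda>w. measure N (cell \<gamma> w))))"
proof -
  interpret finite_measure N by (rule N)
  define s where "s n z = ennreal (cell_inf \<gamma> c (map (\<gamma> z) [0..<n]))" for n z
  have s_mono: "incseq s"
    unfolding s_def by (intro incseq_SucI le_funI ennreal_leI cell_inf_mono c) simp
  have cells: "cell \<gamma> w \<in> sets N" for w
    unfolding N(2) by (rule cell_borel[OF \<gamma>])
  have s_eq: "s n z = (\<Sum>w | length w = n. ennreal (cell_inf \<gamma> c w) * indicator (cell \<gamma> w) z)" for n z
  proof -
    have "(\<Sum>w | length w = n. ennreal (cell_inf \<gamma> c w) * indicator (cell \<gamma> w) z) =
        (\<Sum>w | length w = n. if w = map (\<gamma> z) [0..<n] then ennreal (cell_inf \<gamma> c w) else 0)"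
      by (intro sum.cong) (auto simp: cell_def indicator_def)
    then show ?thesis by (simp add: s_def)
  qed
  have "ennreal (c z) = (SUP n. s n z)" for z
  proof (rule LIMSEQ_unique)
    show "(\<lambda>n. s n z) \<longlonglongrightarrow> ennreal (c z)"
      unfolding s_def by (intro tendsto_ennrealI cell_inf_tendsto[OF \<gamma> c cont])
    show "(\<lambda>n. s n z) \<longlonglongrightarrow> (SUP n. s n z)"
    proof (rule LIMSEQ_SUP)
      show "incseq (\<lambda>n. s n z)"
        using s_mono unfolding incseq_def le_fun_def by blast
    qed
  qed
  then have "transport_cost c N = (\<integral>\<^sup>+z. (SUP n. s n z) \<partial>N)"
    by (simp add: transport_cost_def)
  also have "\<dots> = (SUP n. integral\<^sup>N N (s n))"
  proof (rule nn_integral_monotone_convergence_SUP[OF s_mono])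
    show "s n \<in> borel_measurable N" for n
      unfolding s_eq[abs_def]
      by (intro borel_measurable_sum borel_measurable_times_ennreal borel_measurable_const
          borel_measurable_indicator cells)
  qed
  also have "(\<lambda>n. integral\<^sup>N N (s n)) = (\<lambda>n. ennreal (cell_cost \<gamma> c n (\<lambda>w. measure N (cell \<gamma> w))))"
  proof
    fix n
    have "integral\<^sup>N N (s n) = (\<Sum>w | length w = n. ennreal (cell_inf \<gamma> c w) * emeasure N (cell \<gamma> w))"
      using cells unfolding s_eq by (subst nn_integral_sum) (auto simp: nn_integral_cmult_indicator)
    also have "\<dots> = (\<Sum>w | length w = n. ennreal (cell_inf \<gamma> c w * measure N (cell \<gamma> w)))"
      by (intro sum.cong refl) (simp add: emeasure_eq_measure ennreal_mult cell_inf_nonneg c)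
    also have "\<dots> = ennreal (cell_cost \<gamma> c n (\<lambda>w. measure N (cell \<gamma> w)))"
      unfolding cell_cost_def by (intro sum_ennreal) (simp add: cell_inf_nonneg c)
    finally show "integral\<^sup>N N (s n) = ennreal (cell_cost \<gamma> c n (\<lambda>w. measure N (cell \<gamma> w)))" .
  qed
  finally show ?thesis .
qed

section \<open>Measurability of the unique optimal plan\<close>

lemma closed_projection_along_compact:
  fixes T :: "('a::topological_space \<times> 'b::topological_space) set"
  assumes K: "compact K" and T: "closed T"
  shows "closed {x. \<exists>y\<in>K. (x, y) \<in> T}"
proof -
  have "open (- {x. \<exists>y\<in>K. (x, y) \<in> T})"
  proof (subst open_subopen, rule ballI)
    fix x assume x: "x \<in> - {x. \<exists>y\<in>K. (x, y) \<in> T}"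
    then have "{x} \<times> K \<subseteq> - T" by auto
    then obtain X where "x \<in> X" "open X" "X \<times> K \<subseteq> - T"
      using Elementary_Topology.tube_lemma[OF K open_Compl[OF T], of x] by auto
    then show "\<exists>X. open X \<and> x \<in> X \<and> X \<subseteq> - {x. \<exists>y\<in>K. (x, y) \<in> T}" by blast
  qed
  then show ?thesis by (simp add: closed_def)
qed

lemma splitting_weights_le_1:
  assumes p: "splitting_weights p"
  shows "p w \<le> 1"
proof (induction w rule: rev_induct)
  case (snoc b w)
  then show ?case
    using splitting_weightsD(3)[OF p, of w] splitting_weightsD(2)[OF p, of "w @ [\<not> b]"]
    by (cases b) auto
qed (simp add: splitting_weightsD(1)[OF p])

definition affordable_weights ::
  "('a \<times> 'a \<Rightarrow> nat \<Rightarrow> bool) \<Rightarrow> ('a \<times> 'a \<Rightarrow> real) \<Rightarrow>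
     (bool list \<Rightarrow> real) \<Rightarrow> (bool list \<Rightarrow> real) \<Rightarrow> real \<Rightarrow> (bool list \<Rightarrow> real) \<Rightarrow> bool" where
  "affordable_weights \<gamma> c a b r p \<longleftrightarrow> coupling_weights a b p \<and> (\<forall>n. cell_cost \<gamma> c n p \<le> r)"

text \<open>
  The weights range over the compact space of functions from words to \<open>[0,1]\<close>, so the existential
  quantifier is a projection along a compact factor.
\<close>

lemma closed_affordable:
  "closed {(a, b, r). \<exists>p. affordable_weights \<gamma> c a b r p \<and> p u \<le> t}"
proof -
  define K where "K = (PiE UNIV (\<lambda>_. {0..1}) :: (bool list \<Rightarrow> real) set)"
  define T where "T = {x. affordable_weights \<gamma> c (fst (fst x)) (fst (snd (fst x))) (snd (snd (fst x))) (snd x) \<and> snd x u \<le> t}"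
  have K: "compact K"
    unfolding K_def compactin_euclidean_iff[symmetric] euclidean_product_topology[symmetric]
    by (simp add: compactin_PiE)
  have coord: "continuous_on UNIV (\<lambda>x. f x w)" if "continuous_on UNIV f"
    for f :: "((bool list \<Rightarrow> real) \<times> (bool list \<Rightarrow> real) \<times> real) \<times> (bool list \<Rightarrow> real) \<Rightarrow> bool list \<Rightarrow> real" and w
    using that by (rule continuous_on_product_then_coordinatewise)
  have T: "closed T"
    unfolding T_def affordable_weights_def coupling_weights_def splitting_weights_def cell_cost_def
    by (intro closed_Collect_conj closed_Collect_all closed_Collect_eq closed_Collect_le
         continuous_intros coord)
  have "{(a, b, r). \<exists>p. affordable_weights \<gamma> c a b r p \<and> p u \<le> t} = {x. \<exists>p\<in>K. (x, p) \<in> T}"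
    by (auto simp: T_def K_def affordable_weights_def coupling_weights_def PiE_def Pi_def extensional_def
        dest: splitting_weightsD(2) splitting_weights_le_1 intro!: bexI)
  then show ?thesis
    using closed_projection_along_compact[OF K T] by simp
qed

lemma measurable_affordable:
  assumes a: "\<And>v. (\<lambda>l. a l v) \<in> borel_measurable M" and b: "\<And>v. (\<lambda>l. b l v) \<in> borel_measurable M"
    and r: "r \<in> borel_measurable M"
  shows "{l \<in> space M. \<exists>p. affordable_weights \<gamma> c (a l) (b l) (r l) p \<and> p u \<le> t} \<in> sets M"
proof -
  have [measurable]: "a \<in> borel_measurable M" "b \<in> borel_measurable M"
    using a b by (auto intro: measurable_coordinatewise_then_product)
  note r[measurable]
  have "(\<lambda>l. (a l, b l, r l)) -` {(a, b, r). \<exists>p. affordable_weights \<gamma> c a b r p \<and> p u \<le> t} \<inter> space M \<in> sets M"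
    by (rule measurable_sets[OF _ borel_closed[OF closed_affordable]]) measurable
  then show ?thesis
    by (simp add: vimage_def Int_def conj_commute)
qed

lemma affordable_iff_plan:
  fixes \<beta> :: "'a::{banach, second_countable_topology} \<Rightarrow> nat \<Rightarrow> bool"
  assumes \<beta>: "fine_code \<beta>" and c: "\<And>z. 0 \<le> c z" and cont: "continuous_on UNIV c"
    and \<mu>: "\<mu> \<in> space (prob_algebra borel)" and \<nu>: "\<nu> \<in> space (prob_algebra borel)"
    and r: "0 \<le> r"
  shows "(\<exists>p. affordable_weights (pair_code \<beta>) c
            (\<lambda>v. measure \<mu> (cell \<beta> v)) (\<lambda>v. measure \<nu> (cell \<beta> v)) r p \<and> p u \<le> t) \<longleftrightarrow>
     (\<exists>\<pi>\<in>transference_plans \<mu> \<nu>. transport_cost c \<pi> \<le> ennreal r \<and> measure \<pi> (cell (pair_code \<beta>) u) \<le> t)"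
    (is "?L \<longleftrightarrow> ?R")
proof -
  have cost: "transport_cost c \<pi> \<le> ennreal r \<longleftrightarrow>
      (\<forall>n. cell_cost (pair_code \<beta>) c n (\<lambda>w. measure \<pi> (cell (pair_code \<beta>) w)) \<le> r)"
    if \<pi>: "\<pi> \<in> transference_plans \<mu> \<nu>" for \<pi>
    using transference_planD(1,2)[OF \<pi>] r
    by (subst transport_cost_eq_SUP_cell_cost[OF fine_code_pair[OF \<beta>] c cont])
       (auto simp: SUP_le_iff prob_space.finite_measure)
  show ?thesis
  proof
    assume ?L
    then obtain p where p: "coupling_weights (\<lambda>v. measure \<mu> (cell \<beta> v)) (\<lambda>v. measure \<nu> (cell \<beta> v)) p"
      "\<forall>n. cell_cost (pair_code \<beta>) c n p \<le> r" "p u \<le> t"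
      by (auto simp: affordable_weights_def)
    obtain \<pi> where \<pi>: "\<pi> \<in> transference_plans \<mu> \<nu>" "\<And>w. measure \<pi> (cell (pair_code \<beta>) w) = p w"
      using coupling_weights_realised[OF \<beta> \<mu> \<nu> p(1)] by blast
    then show ?R
      using p(2,3) by (intro bexI[of _ \<pi>]) (simp_all add: cost)
  next
    assume ?R
    then show ?L
      using transference_plan_weights[OF \<beta>] by (auto simp: affordable_weights_def cost)
  qed
qed

text \<open>
  The minimal cost \<open>V l\<close> is at most \<open>r\<close> iff there are coupling weights of cost at most \<open>r\<close>. The optimal
  plan gives mass at most \<open>t\<close> to a cell iff some coupling weights of cost at most \<open>V l\<close> do: by uniqueness
  these can only be the weights of \<open>\<pi> l\<close>. Both conditions are measurable in \<open>l\<close>, the second one because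
  \<open>V\<close> is measurable by the first.
\<close>

lemma measurable_unique_optimal_plan:
  fixes c :: "'a::{banach, second_countable_topology} \<times> 'a \<Rightarrow> real"
  assumes c: "\<And>z. 0 \<le> c z" and cont: "continuous_on UNIV c"
    and \<mu>: "\<mu> \<in> M \<rightarrow>\<^sub>M prob_algebra borel" and \<nu>: "\<nu> \<in> M \<rightarrow>\<^sub>M prob_algebra borel"
    and opt: "\<And>l. l \<in> space M \<Longrightarrow> optimal_plans c (\<mu> l) (\<nu> l) = {\<pi> l}"
  shows "\<pi> \<in> M \<rightarrow>\<^sub>M prob_algebra borel"
proof -
  obtain \<beta> :: "'a \<Rightarrow> nat \<Rightarrow> bool" where \<beta>: "fine_code \<beta>"
    using fine_code_exists by blast
  let ?\<gamma> = "pair_code \<beta>"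
  have \<pi>: "\<pi> l \<in> transference_plans (\<mu> l) (\<nu> l)" "transport_cost c (\<pi> l) < \<infinity>"
    "\<And>\<rho>. \<rho> \<in> transference_plans (\<mu> l) (\<nu> l) \<Longrightarrow> transport_cost c (\<pi> l) \<le> transport_cost c \<rho>"
    "\<And>\<rho>. \<rho> \<in> transference_plans (\<mu> l) (\<nu> l) \<Longrightarrow> transport_cost c \<rho> \<le> transport_cost c (\<pi> l) \<Longrightarrow> \<rho> = \<pi> l"
    if "l \<in> space M" for l
  proof -
    have *: "\<rho> \<in> optimal_plans c (\<mu> l) (\<nu> l) \<longleftrightarrow> \<rho> = \<pi> l" for \<rho>
      using opt[OF that] by simp
    show "\<pi> l \<in> transference_plans (\<mu> l) (\<nu> l)" "transport_cost c (\<pi> l) < \<infinity>"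
      "\<And>\<rho>. \<rho> \<in> transference_plans (\<mu> l) (\<nu> l) \<Longrightarrow> transport_cost c (\<pi> l) \<le> transport_cost c \<rho>"
      using *[of "\<pi> l"] by (auto simp: optimal_plans_def)
    show "\<rho> = \<pi> l" if "\<rho> \<in> transference_plans (\<mu> l) (\<nu> l)" "transport_cost c \<rho> \<le> transport_cost c (\<pi> l)" for \<rho>
      using that *[of "\<pi> l"] *[of \<rho>] by (force simp: optimal_plans_def)
  qed
  have prob: "\<mu> l \<in> space (prob_algebra borel)" "\<nu> l \<in> space (prob_algebra borel)" if "l \<in> space M" for l
    using \<mu> \<nu> that by (auto dest: measurable_space)
  have cells: "(\<lambda>l. measure (\<rho> l) (cell \<beta> v)) \<in> borel_measurable M"
    if "\<rho> \<in> M \<rightarrow>\<^sub>M prob_algebra borel" for \<rho> v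
    using measurable_compose[OF measurable_prob_algebraD[OF that] measurable_measure_subprob_algebra[OF cell_borel[OF \<beta>]]] .
  note affordable = measurable_affordable[OF cells[OF \<mu>] cells[OF \<nu>], where \<gamma>="?\<gamma>" and c=c]
  define V where "V l = enn2real (transport_cost c (\<pi> l))" for l
  have V: "ennreal (V l) = transport_cost c (\<pi> l)" if "l \<in> space M" for l
    using \<pi>(2)[OF that] by (simp add: V_def)
  have [simp]: "0 \<le> V l" for l by (simp add: V_def)
  \<comment> \<open>As \<open>p [] = 1\<close> for all weights, the empty word and \<open>t = 1\<close> turn the mass bound into a tautology.\<close>
  have V_meas: "V \<in> borel_measurable M"
  proof (rule borel_measurable_iff_le[THEN iffD2], rule allI)
    fix r
    show "{l \<in> space M. V l \<le> r} \<in> sets M"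
    proof (cases "0 \<le> r")
      case True
      have "{l \<in> space M. V l \<le> r} = {l \<in> space M. \<exists>p. affordable_weights ?\<gamma> c
          (\<lambda>v. measure (\<mu> l) (cell \<beta> v)) (\<lambda>v. measure (\<nu> l) (cell \<beta> v)) r p \<and> p [] \<le> 1}"
      proof (intro Collect_cong conj_cong refl)
        fix l assume l: "l \<in> space M"
        have "V l \<le> r \<longleftrightarrow> transport_cost c (\<pi> l) \<le> ennreal r"
          using True by (simp add: V[OF l, symmetric])
        also have "\<dots> \<longleftrightarrow> (\<exists>\<rho>\<in>transference_plans (\<mu> l) (\<nu> l).
            transport_cost c \<rho> \<le> ennreal r \<and> measure \<rho> (cell ?\<gamma> []) \<le> 1)"
          using \<pi>(1,3)[OF l] by (auto intro: order_trans prob_space.prob_le_1 dest: transference_planD(1))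
        finally show "V l \<le> r \<longleftrightarrow> (\<exists>p. affordable_weights ?\<gamma> c
          (\<lambda>v. measure (\<mu> l) (cell \<beta> v)) (\<lambda>v. measure (\<nu> l) (cell \<beta> v)) r p \<and> p [] \<le> 1)"
          by (subst affordable_iff_plan[OF \<beta> c cont prob[OF l] True])
      qed
      then show ?thesis
        using affordable[of "\<lambda>_. r"] by simp
    next
      case False
      then have "{l \<in> space M. V l \<le> r} = {}"
        by (auto simp: not_le intro: less_le_trans[of r 0])
      then show ?thesis by (metis sets.empty_sets)
    qed
  qed
  have "(\<lambda>l. measure (\<pi> l) (cell ?\<gamma> u)) \<in> borel_measurable M" for u
  proof (rule borel_measurable_iff_le[THEN iffD2], rule allI)
    fix t
    have "{l \<in> space M. measure (\<pi> l) (cell ?\<gamma> u) \<le> t} = {l \<in> space M. \<exists>p. affordable_weights ?\<gamma> c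
          (\<lambda>v. measure (\<mu> l) (cell \<beta> v)) (\<lambda>v. measure (\<nu> l) (cell \<beta> v)) (V l) p \<and> p u \<le> t}"
    proof (intro Collect_cong conj_cong refl)
      fix l assume l: "l \<in> space M"
      show "measure (\<pi> l) (cell ?\<gamma> u) \<le> t \<longleftrightarrow> (\<exists>p. affordable_weights ?\<gamma> c
          (\<lambda>v. measure (\<mu> l) (cell \<beta> v)) (\<lambda>v. measure (\<nu> l) (cell \<beta> v)) (V l) p \<and> p u \<le> t)"
        using \<pi>(1,4)[OF l]
        by (subst affordable_iff_plan[OF \<beta> c cont prob[OF l]]) (auto simp: V[OF l])
    qed
    then show "{l \<in> space M. measure (\<pi> l) (cell ?\<gamma> u) \<le> t} \<in> sets M"
      using affordable[OF V_meas] by simp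
  qed
  note cells_\<pi> = this
  have prob_\<pi>: "prob_space (\<pi> l)" "sets (\<pi> l) = sets borel" if "l \<in> space M" for l
    using transference_planD(1,2)[OF \<pi>(1)[OF that]] by auto
  show ?thesis
  proof (rule measurable_prob_algebra_generated)
    show "sets borel = sigma_sets UNIV (insert {} (range (cell ?\<gamma>)))"
      by (simp add: sets_borel_eq_cells[OF fine_code_pair[OF \<beta>]] sigma_sets_cells_idem)
    fix A assume "A \<in> insert {} (range (cell ?\<gamma>))"
    then consider "A = {}" | u where "A = cell ?\<gamma> u" by auto
    then show "(\<lambda>l. emeasure (\<pi> l) A) \<in> borel_measurable M"
    proof cases
      case 2
      have "(\<lambda>l. ennreal (measure (\<pi> l) (cell ?\<gamma> u))) \<in> borel_measurable M"
        using cells_\<pi> by simp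
      then show ?thesis
        by (subst measurable_cong[where g="\<lambda>l. ennreal (measure (\<pi> l) (cell ?\<gamma> u))"])
           (auto simp: 2 finite_measure.emeasure_eq_measure[OF prob_space.finite_measure[OF prob_\<pi>(1)]])
    qed simp
  qed (simp_all add: Int_stable_cells prob_\<pi>)
qed

section \<open>Jointly measurable transport maps\<close>

lemma nn_integral_kernel_prod:
  assumes K: "K \<in> M \<rightarrow>\<^sub>M prob_algebra borel" and f: "f \<in> borel_measurable (M \<Otimes>\<^sub>M borel)"
  shows "(\<integral>\<^sup>+z. f z \<partial>kernel_prod M K) = (\<integral>\<^sup>+l. (\<integral>\<^sup>+x. f (l, x) \<partial>K l) \<partial>M)"
proof -
  have "(\<lambda>l. distr (K l) (M \<Otimes>\<^sub>M borel) (Pair l)) \<in> M \<rightarrow>\<^sub>M subprob_algebra (M \<Otimes>\<^sub>M borel)"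
    by (rule measurable_distr2[OF _ measurable_prob_algebraD[OF K]]) simp
  then have "(\<integral>\<^sup>+z. f z \<partial>kernel_prod M K) =
      (\<integral>\<^sup>+l. (\<integral>\<^sup>+z. f z \<partial>distr (K l) (M \<Otimes>\<^sub>M borel) (Pair l)) \<partial>M)"
    unfolding kernel_prod_def by (rule nn_integral_bind[OF f])
  also have "\<dots> = (\<integral>\<^sup>+l. (\<integral>\<^sup>+x. f (l, x) \<partial>K l) \<partial>M)"
  proof (rule nn_integral_cong)
    fix l assume l: "l \<in> space M"
    then have "sets (K l) = sets borel"
      using K by (auto dest!: measurable_space simp: space_prob_algebra)
    then have "Pair l \<in> K l \<rightarrow>\<^sub>M M \<Otimes>\<^sub>M borel"
      using l measurable_Pair1'[of l M borel] by (simp cong: measurable_cong_sets)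
    then show "(\<integral>\<^sup>+z. f z \<partial>distr (K l) (M \<Otimes>\<^sub>M borel) (Pair l)) = (\<integral>\<^sup>+x. f (l, x) \<partial>K l)"
      using f by (simp add: nn_integral_distr)
  qed
  finally show ?thesis .
qed

lemma sets_kernel_prod:
  assumes ne: "space M \<noteq> {}"
  shows "sets (kernel_prod M K) = sets (M \<Otimes>\<^sub>M borel)"
  unfolding kernel_prod_def
  using ne by (intro sets_bind) auto

lemma sigma_finite_kernel_prod:
  assumes M: "sigma_finite_measure M" and K: "K \<in> M \<rightarrow>\<^sub>M prob_algebra borel" and ne: "space M \<noteq> {}"
  shows "sigma_finite_measure (kernel_prod M K)"
proof -
  interpret sigma_finite_measure M by (rule M)
  obtain A :: "nat \<Rightarrow> 'a set" where A: "range A \<subseteq> sets M" "(\<Union>i. A i) = space M" "\<And>i. emeasure M (A i) \<noteq> \<infinity>"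
    using sigma_finite by metis
  have prob: "prob_space (K l)" "space (K l) = UNIV" if "l \<in> space M" for l
    using measurable_space[OF K that] sets_eq_imp_space_eq[of "K l" borel] by (auto simp: space_prob_algebra)
  have sets: "A i \<times> UNIV \<in> sets (M \<Otimes>\<^sub>M borel)" for i
    using A(1) by (intro pair_measureI) auto
  have "emeasure (kernel_prod M K) (A i \<times> UNIV) = emeasure M (A i)" for i
  proof -
    have "emeasure (kernel_prod M K) (A i \<times> UNIV) = (\<integral>\<^sup>+l. emeasure (K l) (Pair l -` (A i \<times> UNIV)) \<partial>M)"
      by (rule emeasure_kernel_prod[OF K ne sets])
    also have "\<dots> = (\<integral>\<^sup>+l. indicator (A i) l \<partial>M)"
    proof (rule nn_integral_cong)
      fix l assume "l \<in> space M"
      then show "emeasure (K l) (Pair l -` (A i \<times> UNIV)) = indicator (A i) l"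
        using prob_space.emeasure_space_1[OF prob(1)] prob(2) by (cases "l \<in> A i") (auto simp: vimage_def)
    qed
    also have "\<dots> = emeasure M (A i)" using A(1) by (intro nn_integral_indicator) auto
    finally show ?thesis .
  qed
  then show ?thesis
    using A sets
    by (intro sigma_finite_measure.intro exI[of _ "range (\<lambda>i. A i \<times> UNIV)"])
       (auto simp: sets_kernel_prod[OF ne] sets_eq_imp_space_eq[OF sets_kernel_prod[OF ne]] space_pair_measure)
qed

text \<open>
  As \<open>T\<close> is measurable only for each \<open>l\<close> separately, it cannot be integrated over \<open>l\<close>. The kernel \<open>\<pi>\<close>
  can, and its values are the images of \<open>\<mu> l\<close> under \<open>x \<mapsto> (x, T l x)\<close>; Radon-Nikodym densities of measures
  built from \<open>\<pi>\<close> recover the code of \<open>T l x\<close> as a jointly measurable function.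
\<close>

lemma jointly_measurable_transport_map:
  fixes \<mu> :: "'e \<Rightarrow> ('a::{banach, second_countable_topology}) measure" and \<pi> :: "'e \<Rightarrow> ('a \<times> 'a) measure"
    and T :: "'e \<Rightarrow> 'a \<Rightarrow> 'a"
  assumes M: "sigma_finite_measure M" and \<mu>: "\<mu> \<in> M \<rightarrow>\<^sub>M prob_algebra borel"
    and \<pi>: "\<pi> \<in> M \<rightarrow>\<^sub>M prob_algebra borel"
    and T: "AE l in M. T l \<in> borel_measurable borel \<and> (\<forall>A\<in>sets borel. \<forall>B\<in>sets borel.
              emeasure (\<pi> l) (A \<times> B) = emeasure (\<mu> l) (A \<inter> T l -` B))"
  obtains Tj where "Tj \<in> M \<Otimes>\<^sub>M borel \<rightarrow>\<^sub>M borel" "AE l in M. AE x in \<mu> l. Tj (l, x) = T l x"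
proof (cases "space M = {}")
  case True
  show ?thesis
    by (rule that[of "\<lambda>_. 0"]) (auto intro!: AE_I2 simp: True)
next
  case ne: False
  interpret M: sigma_finite_measure M by (rule M)
  obtain \<beta> :: "'a \<Rightarrow> nat \<Rightarrow> bool" where \<beta>: "fine_code \<beta>"
    using fine_code_exists by blast
  obtain g where g: "g \<in> bit_sequences \<rightarrow>\<^sub>M borel" "\<And>x. g (\<beta> x) = x"
    using fine_code_decode[OF \<beta>] by metis
  define R where "R = kernel_prod M \<mu>"
  define Q where "Q = kernel_prod M \<pi>"
  define U where "U i = {y. \<beta> y i}" for i
  \<comment> \<open>The measure \<open>A \<mapsto> \<integral> \<pi> l (A\<^sub>l \<times> U i) M(dl)\<close>, whose density is the \<open>i\<close>-th bit of the code of \<open>T l x\<close>.\<close>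
  define QU where "QU i = distr (density Q (\<lambda>z. indicator (U i) (snd (snd z)))) (M \<Otimes>\<^sub>M borel)
      (\<lambda>z. (fst z, fst (snd z)))" for i
  define k where "k i = RN_deriv R (QU i)" for i
  have U: "U i \<in> sets borel" for i
    using \<beta> by (auto simp: U_def fine_code_def)
  have sR[measurable_cong]: "sets R = sets (M \<Otimes>\<^sub>M borel)"
    unfolding R_def by (rule sets_kernel_prod[OF ne])
  have sQ[measurable_cong]: "sets Q = sets (M \<Otimes>\<^sub>M (borel \<Otimes>\<^sub>M borel))"
    unfolding Q_def sets_kernel_prod[OF ne] borel_prod ..
  interpret R: sigma_finite_measure R
    unfolding R_def by (rule sigma_finite_kernel_prod[OF M \<mu> ne])
  note U[measurable]
  have prob: "prob_space (\<mu> l)" "sets (\<mu> l) = sets borel" "space (\<mu> l) = UNIV"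
      "prob_space (\<pi> l)" "sets (\<pi> l) = sets borel" if "l \<in> space M" for l
    using measurable_space[OF \<mu> that] sets_eq_imp_space_eq[of "\<mu> l" borel] measurable_space[OF \<pi> that]
    by (auto simp: space_prob_algebra)
  have QU: "emeasure (QU i) A = (\<integral>\<^sup>+l. emeasure (\<pi> l) ((Pair l -` A) \<times> U i) \<partial>M)"
    if A: "A \<in> sets (M \<Otimes>\<^sub>M borel)" for i A
  proof -
    note A[measurable]
    let ?S = "{z \<in> space (M \<Otimes>\<^sub>M (borel \<Otimes>\<^sub>M borel)). (fst z, fst (snd z)) \<in> A \<and> snd (snd z) \<in> U i}"
    have S: "?S \<in> sets (M \<Otimes>\<^sub>M (borel \<Otimes>\<^sub>M borel))" by measurable
    have spQ: "space Q = space (M \<Otimes>\<^sub>M (borel \<Otimes>\<^sub>M borel))"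
      by (rule sets_eq_imp_space_eq[OF sQ])
    have "emeasure (QU i) A = emeasure (density Q (\<lambda>z. indicator (U i) (snd (snd z))))
        ((\<lambda>z. (fst z, fst (snd z))) -` A \<inter> space Q)"
      unfolding QU_def by (subst emeasure_distr) (auto simp: A)
    also have "\<dots> = (\<integral>\<^sup>+z. indicator (U i) (snd (snd z)) *
        indicator ((\<lambda>z. (fst z, fst (snd z))) -` A \<inter> space Q) z \<partial>Q)"
      by (rule emeasure_density) measurable
    also have "\<dots> = (\<integral>\<^sup>+z. indicator ?S z \<partial>Q)"
      by (intro nn_integral_cong) (auto simp: indicator_def spQ)
    also have "\<dots> = emeasure Q ?S"
      using S by (intro nn_integral_indicator) (simp add: sQ)
    also have "\<dots> = (\<integral>\<^sup>+l. emeasure (\<pi> l) (Pair l -` ?S) \<partial>M)"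
      using S unfolding Q_def borel_prod by (intro emeasure_kernel_prod[OF \<pi> ne])
    also have "\<dots> = (\<integral>\<^sup>+l. emeasure (\<pi> l) ((Pair l -` A) \<times> U i) \<partial>M)"
      by (intro nn_integral_cong arg_cong2[where f=emeasure] refl) (auto simp: space_pair_measure)
    finally show ?thesis .
  qed
  have ac: "absolutely_continuous R (QU i)" for i
    unfolding absolutely_continuous_def
  proof
    fix A assume A: "A \<in> null_sets R"
    then have As: "A \<in> sets (M \<Otimes>\<^sub>M borel)" using sR by auto
    have sec: "Pair l -` A \<in> sets borel" for l
      using As by (rule sets_Pair1)
    have meas: "(\<lambda>l. emeasure (\<mu> l) (Pair l -` A)) \<in> borel_measurable M"
    proof (rule emeasure_measurable_subprob_algebra2[OF _ measurable_prob_algebraD[OF \<mu>]])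
      have "Sigma (space M) (\<lambda>l. Pair l -` A) = A"
        using sets.sets_into_space[OF As] by (auto simp: space_pair_measure)
      then show "Sigma (space M) (\<lambda>l. Pair l -` A) \<in> sets (M \<Otimes>\<^sub>M borel)"
        using As by simp
    qed
    have "(\<integral>\<^sup>+l. emeasure (\<mu> l) (Pair l -` A) \<partial>M) = 0"
      using A unfolding R_def by (subst emeasure_kernel_prod[OF \<mu> ne As, symmetric]) auto
    then have "AE l in M. emeasure (\<mu> l) (Pair l -` A) = 0"
      using meas by (simp add: nn_integral_0_iff_AE)
    with T AE_space have "AE l in M. emeasure (\<pi> l) ((Pair l -` A) \<times> U i) = 0"
    proof eventually_elim
      case (elim l)
      then have "emeasure (\<pi> l) ((Pair l -` A) \<times> U i) = emeasure (\<mu> l) (Pair l -` A \<inter> T l -` U i)"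
        using sec U by blast
      also have "\<dots> \<le> emeasure (\<mu> l) (Pair l -` A)"
        using elim sec by (intro emeasure_mono) (auto simp: prob(2))
      finally show ?case using elim by simp
    qed
    then have "emeasure (QU i) A = 0"
      unfolding QU[OF As] by (simp add: nn_integral_cong_AE[of _ "\<lambda>_. 0"])
    then show "A \<in> null_sets (QU i)"
      using As by (auto simp: null_sets_def QU_def)
  qed
  have k: "density R (k i) = QU i" for i
    unfolding k_def by (rule R.density_RN_deriv[OF ac]) (simp add: QU_def sR)
  have k_meas: "k i \<in> borel_measurable (M \<Otimes>\<^sub>M borel)" for i
    unfolding k_def using borel_measurable_RN_deriv[of R] by (simp cong: measurable_cong_sets add: sR)
  note k_meas[measurable]
  note cell_borel[OF \<beta>, measurable]
  \<comment> \<open>Integrating the density over rectangles \<open>L \<times> cell \<beta> v\<close> with \<open>L\<close> arbitrary removes the integral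
    over \<open>l\<close>. There are countably many cells, so one null set of \<open>l\<close> serves all of them.\<close>
  have "AE l in M. emeasure (\<pi> l) (cell \<beta> v \<times> U i) = (\<integral>\<^sup>+x. k i (l, x) * indicator (cell \<beta> v) x \<partial>\<mu> l)" for i v
  proof (rule M.density_unique_iff[THEN iffD1])
    have "cell \<beta> v \<times> U i \<in> sets borel"
      unfolding borel_prod[symmetric] by measurable
    then show 1: "(\<lambda>l. emeasure (\<pi> l) (cell \<beta> v \<times> U i)) \<in> borel_measurable M"
      using measurable_compose[OF measurable_prob_algebraD[OF \<pi>] measurable_emeasure_subprob_algebra] by blast
    show 2: "(\<lambda>l. \<integral>\<^sup>+x. k i (l, x) * indicator (cell \<beta> v) x \<partial>\<mu> l) \<in> borel_measurable M"
      by (rule nn_integral_measurable_subprob_algebra2[OF _ measurable_prob_algebraD[OF \<mu>]]) measurable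
    show "density M (\<lambda>l. emeasure (\<pi> l) (cell \<beta> v \<times> U i)) =
        density M (\<lambda>l. \<integral>\<^sup>+x. k i (l, x) * indicator (cell \<beta> v) x \<partial>\<mu> l)"
    proof (rule measure_eqI)
      fix L assume "L \<in> sets (density M (\<lambda>l. emeasure (\<pi> l) (cell \<beta> v \<times> U i)))"
      then have L[measurable]: "L \<in> sets M" by simp
      have LA: "L \<times> cell \<beta> v \<in> sets (M \<Otimes>\<^sub>M borel)" by measurable
      have "emeasure (density M (\<lambda>l. emeasure (\<pi> l) (cell \<beta> v \<times> U i))) L =
          (\<integral>\<^sup>+l. emeasure (\<pi> l) (cell \<beta> v \<times> U i) * indicator L l \<partial>M)"
        by (rule emeasure_density[OF 1 L])
      also have "\<dots> = (\<integral>\<^sup>+l. emeasure (\<pi> l) ((Pair l -` (L \<times> cell \<beta> v)) \<times> U i) \<partial>M)"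
        by (intro nn_integral_cong) (auto simp: indicator_def vimage_def)
      also have "\<dots> = emeasure (QU i) (L \<times> cell \<beta> v)"
        by (rule QU[OF LA, symmetric])
      also have "\<dots> = (\<integral>\<^sup>+z. k i z * indicator (L \<times> cell \<beta> v) z \<partial>R)"
        unfolding k[symmetric] by (rule emeasure_density) (use LA in \<open>auto simp: sR\<close>)
      also have "\<dots> = (\<integral>\<^sup>+l. (\<integral>\<^sup>+x. k i (l, x) * indicator (L \<times> cell \<beta> v) (l, x) \<partial>\<mu> l) \<partial>M)"
        unfolding R_def by (rule nn_integral_kernel_prod[OF \<mu>]) (use LA in measurable)
      also have "\<dots> = (\<integral>\<^sup>+l. (\<integral>\<^sup>+x. k i (l, x) * indicator (cell \<beta> v) x \<partial>\<mu> l) * indicator L l \<partial>M)"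
        by (intro nn_integral_cong) (auto simp: indicator_def)
      also have "\<dots> = emeasure (density M (\<lambda>l. \<integral>\<^sup>+x. k i (l, x) * indicator (cell \<beta> v) x \<partial>\<mu> l)) L"
        by (rule emeasure_density[OF 2 L, symmetric])
      finally show "emeasure (density M (\<lambda>l. emeasure (\<pi> l) (cell \<beta> v \<times> U i))) L =
          emeasure (density M (\<lambda>l. \<integral>\<^sup>+x. k i (l, x) * indicator (cell \<beta> v) x \<partial>\<mu> l)) L" .
    qed simp
  qed
  then have "AE l in M. \<forall>i v. emeasure (\<pi> l) (cell \<beta> v \<times> U i) = (\<integral>\<^sup>+x. k i (l, x) * indicator (cell \<beta> v) x \<partial>\<mu> l)"
    by (simp add: AE_all_countable)
  then have AE_k: "AE l in M. \<forall>i. AE x in \<mu> l. k i (l, x) = indicator (T l -` U i) x"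
    using T AE_space
  proof eventually_elim
    case (elim l)
    note l = \<open>l \<in> space M\<close>
    interpret \<mu>l: prob_space "\<mu> l" by (rule prob[OF l])
    interpret \<pi>l: prob_space "\<pi> l" by (rule prob[OF l])
    note prob(2)[OF l, measurable_cong]
    have Tl[measurable]: "T l \<in> borel_measurable borel" using elim by blast
    show ?case
    proof
      fix i
      have [measurable]: "(\<lambda>x. k i (l, x)) \<in> borel_measurable borel"
        by (rule measurable_compose[OF measurable_Pair1'[OF l] k_meas])
      have TU[measurable]: "T l -` U i \<in> sets borel"
        using measurable_sets[OF Tl U[of i]] by simp
      have "density (\<mu> l) (\<lambda>x. k i (l, x)) = density (\<mu> l) (indicator (T l -` U i))"
      proof (rule measure_eq_if_eq_on_cells[of _ \<beta>])
        show "sets (density (\<mu> l) (\<lambda>x. k i (l, x))) = sigma_sets UNIV (range (cell \<beta>))"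
          by (simp add: prob(2)[OF l] sets_borel_eq_cells[OF \<beta>])
        have *: "emeasure (density (\<mu> l) (\<lambda>x. k i (l, x))) (cell \<beta> v) = emeasure (\<pi> l) (cell \<beta> v \<times> U i)" for v
          using elim by (subst emeasure_density) (auto simp: prob(2)[OF l])
        show "finite_measure (density (\<mu> l) (\<lambda>x. k i (l, x)))"
          by (rule finite_measureI) (use *[of "[]"] in \<open>simp add: prob(3)[OF l]\<close>)
        fix v
        have "emeasure (density (\<mu> l) (indicator (T l -` U i))) (cell \<beta> v) =
            emeasure (\<mu> l) (cell \<beta> v \<inter> T l -` U i)"
          by (subst emeasure_density) (auto simp: prob(2)[OF l] indicator_inter_arith[symmetric] Int_commute)
        then show "emeasure (density (\<mu> l) (\<lambda>x. k i (l, x))) (cell \<beta> v) =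
            emeasure (density (\<mu> l) (indicator (T l -` U i))) (cell \<beta> v)"
          unfolding * using elim cell_borel[OF \<beta>] U by simp
      qed simp
      then show "AE x in \<mu> l. k i (l, x) = indicator (T l -` U i) x"
        by (subst (asm) \<mu>l.density_unique_iff) auto
    qed
  qed
  show ?thesis
  proof (rule that[of "\<lambda>z. g (\<lambda>i. k i z = 1)"])
    show "(\<lambda>z. g (\<lambda>i. k i z = 1)) \<in> M \<Otimes>\<^sub>M borel \<rightarrow>\<^sub>M borel"
      by (rule measurable_compose[OF _ g(1)], rule measurable_PiM_single') auto
    show "AE l in M. AE x in \<mu> l. g (\<lambda>i. k i (l, x) = 1) = T l x"
      using AE_k
    proof eventually_elim
      case (elim l)
      then have "AE x in \<mu> l. \<forall>i. k i (l, x) = indicator (T l -` U i) x"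
        by (simp add: AE_all_countable)
      then show ?case
      proof eventually_elim
        case (elim x)
        then have "(\<lambda>i. k i (l, x) = 1) = \<beta> (T l x)"
          by (auto simp: U_def indicator_def fun_eq_iff)
        then show ?case by (simp add: g(2))
      qed
    qed
  qed
qed

section \<open>The weak topology and evaluation on sets\<close>

text \<open>
  The mass of a closed set \<open>C\<close> is the limit of the integrals of the continuous functions
  \<open>max 0 (1 - n dist(x, C))\<close>, and closed sets form a generator closed under intersection.
\<close>

lemma measurable_prob_algebra_if_weak_borel:
  fixes \<mu> :: "'e \<Rightarrow> 'a::metric_space measure"
  assumes \<mu>: "\<mu> \<in> M \<rightarrow>\<^sub>M weak_borel"
  shows "\<mu> \<in> M \<rightarrow>\<^sub>M prob_algebra borel"
proof -
  have sub: "{U. openin (weak_topology :: 'a measure topology) U} \<subseteq> Pow (topspace weak_topology)"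
    by (auto dest: openin_subset)
  have prob: "prob_space (\<mu> l)" "sets (\<mu> l) = sets borel" if "l \<in> space M" for l
    using measurable_space[OF \<mu> that]
    unfolding weak_borel_def space_measure_of_conv topspace_weak_topology by (auto simp: space_prob_algebra)
  have cont: "(\<lambda>l. \<integral>x. f x \<partial>\<mu> l) \<in> borel_measurable M"
    if f: "continuous_on UNIV f" "bounded (range f)" for f :: "'a \<Rightarrow> real"
  proof (rule borel_measurableI)
    fix S :: "real set" assume S: "open S"
    have "openin weak_topology {\<rho> \<in> space (prob_algebra borel). (\<integral>x. f x \<partial>\<rho>) \<in> S}"
      unfolding weak_topology_def using f S by (intro topology_generated_by_Basis) blast
    then have "{\<rho> \<in> space (prob_algebra borel). (\<integral>x. f x \<partial>\<rho>) \<in> S} \<in> sets weak_borel"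
      unfolding weak_borel_def by (simp add: sets_measure_of[OF sub])
    then have "\<mu> -` {\<rho> \<in> space (prob_algebra borel). (\<integral>x. f x \<partial>\<rho>) \<in> S} \<inter> space M \<in> sets M"
      by (rule measurable_sets[OF \<mu>])
    also have "\<mu> -` {\<rho> \<in> space (prob_algebra borel). (\<integral>x. f x \<partial>\<rho>) \<in> S} \<inter> space M =
        (\<lambda>l. \<integral>x. f x \<partial>\<mu> l) -` S \<inter> space M"
      using prob by (auto simp: space_prob_algebra)
    finally show "(\<lambda>l. \<integral>x. f x \<partial>\<mu> l) -` S \<inter> space M \<in> sets M" .
  qed
  have closed: "(\<lambda>l. measure (\<mu> l) C) \<in> borel_measurable M" if C: "closed C" "C \<noteq> {}" for C
  proof (rule borel_measurable_LIMSEQ_real)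
    define f where "f n x = max 0 (1 - real n * infdist x C)" for n x
    have f: "continuous_on UNIV (f n)" "bounded (range (f n))" "f n \<in> borel_measurable borel" "0 \<le> f n x" "f n x \<le> 1" for n x
    proof -
      show 1: "continuous_on UNIV (f n)"
        unfolding f_def by (intro continuous_intros)
      show 2: "0 \<le> f n x" "f n x \<le> 1" for x
        by (auto simp: f_def infdist_nonneg)
      show "bounded (range (f n))"
        using 2 by (auto simp: bounded_iff intro!: exI[of _ 1])
      show "f n \<in> borel_measurable borel"
        by (rule borel_measurable_continuous_onI[OF 1])
    qed
    have lim: "(\<lambda>n. f n x) \<longlonglongrightarrow> indicator C x" for x
    proof (cases "x \<in> C")
      case True
      then show ?thesis by (simp add: f_def)
    next
      case False
      then have pos: "0 < infdist x C"
        using C infdist_pos_not_in_closed by blast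
      then obtain m where m: "1 < real m * infdist x C"
        using reals_Archimedean3 by blast
      have "f n x = 0" if "m \<le> n" for n
      proof -
        have "real m * infdist x C \<le> real n * infdist x C"
          using that pos by (intro mult_right_mono) auto
        then show ?thesis using m by (simp add: f_def)
      qed
      then show ?thesis
        using False by (intro tendsto_eventually) (auto simp: eventually_sequentially)
    qed
    show "(\<lambda>l. \<integral>x. f n x \<partial>\<mu> l) \<in> borel_measurable M" for n
      by (rule cont[OF f(1,2)])
    fix l assume l: "l \<in> space M"
    interpret prob_space "\<mu> l" by (rule prob[OF l])
    note prob(2)[OF l, measurable_cong]
    have "(\<lambda>n. \<integral>x. f n x \<partial>\<mu> l) \<longlonglongrightarrow> (\<integral>x. indicator C x \<partial>\<mu> l)"
    proof (rule integral_dominated_convergence[where w="\<lambda>_. 1"])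
      show "(indicator C :: 'a \<Rightarrow> real) \<in> borel_measurable (\<mu> l)"
        using C by (intro borel_measurable_indicator) (simp add: prob(2)[OF l])
      show "f n \<in> borel_measurable (\<mu> l)" for n using f(3) by measurable
    qed (use f lim in auto)
    then show "(\<lambda>n. \<integral>x. f n x \<partial>\<mu> l) \<longlonglongrightarrow> measure (\<mu> l) C"
      using C by (simp add: prob(2)[OF l] sets_eq_imp_space_eq[OF prob(2)[OF l]])
  qed
  show ?thesis
  proof (rule measurable_prob_algebra_generated)
    show "sets borel = sigma_sets UNIV {C :: 'a set. closed C}"
      unfolding borel_eq_closed by (simp add: sets_measure_of)
    show "Int_stable {C :: 'a set. closed C}" by (auto simp: Int_stable_def)
    fix C :: "'a set" assume "C \<in> {C. closed C}"
    then have C: "closed C" by simp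
    show "(\<lambda>l. emeasure (\<mu> l) C) \<in> borel_measurable M"
    proof (cases "C = {}")
      case False
      have "(\<lambda>l. ennreal (measure (\<mu> l) C)) \<in> borel_measurable M"
        using closed[OF C False] by simp
      then show ?thesis
        by (subst measurable_cong[where g="\<lambda>l. ennreal (measure (\<mu> l) C)"])
           (auto simp: finite_measure.emeasure_eq_measure[OF prob_space.finite_measure[OF prob(1)]])
    qed simp
  qed (simp_all add: prob)
qed

section \<open>Measurability of the optimal transport map\<close>

lemma induced_by_map_Times:
  fixes T :: "'a::second_countable_topology \<Rightarrow> 'a"
  assumes \<pi>: "induced_by_map \<mu> \<pi> T" and \<mu>: "\<mu> \<in> space (prob_algebra borel)"
    and A: "A \<in> sets borel" and B: "B \<in> sets borel"
  shows "emeasure \<pi> (A \<times> B) = emeasure \<mu> (A \<inter> T -` B)"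
proof -
  have T: "T \<in> borel \<rightarrow>\<^sub>M borel" and \<pi>_eq: "\<pi> = kernel_prod \<mu> (\<lambda>x. return borel (T x))"
    using \<pi> by (auto simp: induced_by_map_def)
  have s\<mu>: "sets \<mu> = sets borel" using \<mu> by (simp add: space_prob_algebra)
  have space: "space \<mu> = UNIV" using sets_eq_imp_space_eq[OF s\<mu>] by simp
  have K: "(\<lambda>x. return borel (T x)) \<in> \<mu> \<rightarrow>\<^sub>M prob_algebra borel"
    unfolding measurable_cong_sets[OF s\<mu> refl]
    by (rule measurable_compose[OF T measurable_return_prob_space])
  have AB: "A \<times> B \<in> sets (\<mu> \<Otimes>\<^sub>M borel)"
    using A B by (intro pair_measureI) (simp_all add: s\<mu>)
  have "emeasure \<pi> (A \<times> B) = (\<integral>\<^sup>+x. emeasure (return borel (T x)) (Pair x -` (A \<times> B)) \<partial>\<mu>)"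
    unfolding \<pi>_eq by (rule emeasure_kernel_prod[OF K _ AB]) (simp add: space)
  also have "\<dots> = (\<integral>\<^sup>+x. indicator (A \<inter> T -` B) x \<partial>\<mu>)"
    by (intro nn_integral_cong) (use B in \<open>auto simp: indicator_def vimage_def\<close>)
  also have "\<dots> = emeasure \<mu> (A \<inter> T -` B)"
    using A measurable_sets[OF T B] by (intro nn_integral_indicator) (auto simp: s\<mu>)
  finally show ?thesis .
qed

text \<open>
  The exceptional set lies in a measurable null set, and almost all sections of the latter are null.
\<close>

lemma AE_kernel_prodD:
  assumes K: "K \<in> M \<rightarrow>\<^sub>M prob_algebra borel" and ae: "AE z in kernel_prod M K. P z"
  shows "AE l in M. AE x in K l. P (l, x)"
proof (cases "space M = {}")
  case True
  then show ?thesis by (auto intro!: AE_I2)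
next
  case ne: False
  obtain N where N: "{z \<in> space (kernel_prod M K). \<not> P z} \<subseteq> N" "emeasure (kernel_prod M K) N = 0"
      "N \<in> sets (kernel_prod M K)"
    using ae by (rule AE_E)
  have N': "N \<in> sets (M \<Otimes>\<^sub>M borel)"
    using N(3) unfolding sets_kernel_prod[OF ne] .
  have "(\<lambda>l. emeasure (K l) (Pair l -` N)) \<in> borel_measurable M"
  proof (rule emeasure_measurable_subprob_algebra2[OF _ measurable_prob_algebraD[OF K]])
    have "Sigma (space M) (\<lambda>l. Pair l -` N) = N"
      using sets.sets_into_space[OF N'] by (auto simp: space_pair_measure)
    then show "Sigma (space M) (\<lambda>l. Pair l -` N) \<in> sets (M \<Otimes>\<^sub>M borel)"
      using N' by simp
  qed
  moreover have "(\<integral>\<^sup>+l. emeasure (K l) (Pair l -` N) \<partial>M) = 0"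
    using N(2) by (simp add: emeasure_kernel_prod[OF K ne N'])
  ultimately have "AE l in M. emeasure (K l) (Pair l -` N) = 0"
    by (simp add: nn_integral_0_iff_AE)
  then show ?thesis
    using AE_space
  proof eventually_elim
    case (elim l)
    have "sets (K l) = sets borel"
      using measurable_space[OF K elim(2)] by (simp add: space_prob_algebra)
    then have "Pair l -` N \<in> null_sets (K l)"
      using elim(1) sets_Pair1[OF N'] by (auto simp: null_sets_def)
    then show ?case
    proof (rule AE_I')
      show "{x \<in> space (K l). \<not> P (l, x)} \<subseteq> Pair l -` N"
        using N(1) elim(2)
        by (auto simp: sets_eq_imp_space_eq[OF sets_kernel_prod[OF ne]] space_pair_measure)
    qed
  qed
qed

lemma measurable_completion_if_AE_eq:
  assumes f: "f \<in> N \<rightarrow>\<^sub>M borel" and eq: "AE z in N. g z = f z"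
  shows "g \<in> completion N \<rightarrow>\<^sub>M borel"
proof (rule measurableI)
  fix A :: "'b set" assume A: "A \<in> sets borel"
  have "AE z in completion N. z \<in> f -` A \<inter> space N \<longleftrightarrow> z \<in> g -` A \<inter> space N"
    using eq by (intro AE_completion) auto
  moreover have "f -` A \<inter> space N \<in> sets (completion N)"
    using measurable_sets[OF f A] by simp
  ultimately have "g -` A \<inter> space N \<in> sets (completion N)"
    by (rule completion.in_sets_AE) auto
  then show "g -` A \<inter> space (completion N) \<in> sets (completion N)" by simp
qed simp

theorem theorem1p1:
  fixes c :: "(real ^ 'd) \<times> (real ^ 'd) \<Rightarrow> real"
    and M :: "'e measure"
    and \<mu> \<nu> :: "'e \<Rightarrow> (real ^ 'd) measure"
    and T :: "'e \<Rightarrow> real ^ 'd \<Rightarrow> real ^ 'd"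
  assumes c_nonneg: "\<And>z. 0 \<le> c z"
    and c_cont: "continuous_on UNIV c"
    and M: "sigma_finite_measure M"
    and meas: "(\<lambda>l. (\<mu> l, \<nu> l)) \<in> M \<rightarrow>\<^sub>M weak_borel \<Otimes>\<^sub>M weak_borel"
    and H: "AE l in M. assumption_H c (\<mu> l) (\<nu> l)"
    and T: "AE l in M. optimal_transport_map c (\<mu> l) (\<nu> l) (T l)"
  shows "\<exists>Tj \<in> M \<Otimes>\<^sub>M borel \<rightarrow>\<^sub>M borel.
           (AE l in M. AE x in \<mu> l. Tj (l, x) = T l x) \<and>
           (\<forall>S. (AE z in kernel_prod M \<mu>. S z = Tj z) \<longrightarrow>
                (AE l in M. AE x in \<mu> l. S (l, x) = T l x) \<and>
                S \<in> completion (kernel_prod M \<mu>) \<rightarrow>\<^sub>M borel)"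
proof -
  have \<mu>: "\<mu> \<in> M \<rightarrow>\<^sub>M prob_algebra borel"
    by (rule measurable_prob_algebra_if_weak_borel) (use measurable_compose[OF meas measurable_fst] in simp)
  have \<nu>: "\<nu> \<in> M \<rightarrow>\<^sub>M prob_algebra borel"
    by (rule measurable_prob_algebra_if_weak_borel) (use measurable_compose[OF meas measurable_snd] in simp)
  have "AE l in M. assumption_H c (\<mu> l) (\<nu> l) \<and> optimal_transport_map c (\<mu> l) (\<nu> l) (T l)"
    using H T by eventually_elim simp
  then obtain N where N: "{l \<in> space M. \<not> (assumption_H c (\<mu> l) (\<nu> l) \<and> optimal_transport_map c (\<mu> l) (\<nu> l) (T l))} \<subseteq> N"
      "emeasure M N = 0" "N \<in> sets M"
    by (rule AE_E)
  \<comment> \<open>Exceptional parameters get an arbitrary fixed measure, which keeps the kernel measurable on the whole space.\<close>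
  define \<pi> where "\<pi> l = (if l \<in> space M - N then SOME \<pi>. optimal_plans c (\<mu> l) (\<nu> l) = {\<pi>} else return borel 0)" for l
  have opt: "optimal_plans c (\<mu> l) (\<nu> l) = {\<pi> l}" "induced_by_map (\<mu> l) (\<pi> l) (T l)" if l: "l \<in> space M - N" for l
  proof -
    have good: "assumption_H c (\<mu> l) (\<nu> l)" "optimal_transport_map c (\<mu> l) (\<nu> l) (T l)"
      using l N(1) by auto
    have "\<exists>\<pi>. optimal_plans c (\<mu> l) (\<nu> l) = {\<pi>}"
      using good(1) unfolding assumption_H_def by blast
    then show eq: "optimal_plans c (\<mu> l) (\<nu> l) = {\<pi> l}"
      using l someI_ex[of "\<lambda>\<rho>. optimal_plans c (\<mu> l) (\<nu> l) = {\<rho>}"] by (simp add: \<pi>_def)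
    show "induced_by_map (\<mu> l) (\<pi> l) (T l)"
      using good(2) by (simp add: optimal_transport_map_def eq)
  qed
  have \<pi>: "\<pi> \<in> M \<rightarrow>\<^sub>M prob_algebra borel"
    unfolding \<pi>_def
  proof (rule measurable_restrict_space_iff[THEN iffD1])
    let ?G = "restrict_space M (space M - N)"
    have spG: "space ?G = space M - N" by (auto simp: space_restrict_space)
    show "(\<lambda>l. SOME \<pi>. optimal_plans c (\<mu> l) (\<nu> l) = {\<pi>}) \<in> ?G \<rightarrow>\<^sub>M prob_algebra borel"
    proof (rule measurable_unique_optimal_plan[OF c_nonneg c_cont])
      show "\<mu> \<in> ?G \<rightarrow>\<^sub>M prob_algebra borel" "\<nu> \<in> ?G \<rightarrow>\<^sub>M prob_algebra borel"
        using \<mu> \<nu> by (auto intro: measurable_restrict_space1)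
      show "optimal_plans c (\<mu> l) (\<nu> l) = {SOME \<pi>. optimal_plans c (\<mu> l) (\<nu> l) = {\<pi>}}" if "l \<in> space ?G" for l
        using opt(1)[of l] that by (auto simp: spG \<pi>_def)
    qed
    show "(space M - N) \<inter> space M \<in> sets M" using N(3) by auto
    show "return borel 0 \<in> space (prob_algebra borel)"
      by (simp add: space_prob_algebra prob_space_return)
  qed
  have T_\<pi>: "AE l in M. T l \<in> borel_measurable borel \<and> (\<forall>A\<in>sets borel. \<forall>B\<in>sets borel.
      emeasure (\<pi> l) (A \<times> B) = emeasure (\<mu> l) (A \<inter> T l -` B))"
  proof (rule AE_I[OF _ N(2,3)])
    have "T l \<in> borel_measurable borel \<and> (\<forall>A\<in>sets borel. \<forall>B\<in>sets borel.
      emeasure (\<pi> l) (A \<times> B) = emeasure (\<mu> l) (A \<inter> T l -` B))" if l: "l \<in> space M - N" for l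
    proof -
      have "\<mu> l \<in> space (prob_algebra borel)"
        using l measurable_space[OF \<mu>] by blast
      then show ?thesis
        using opt(2)[OF l] by (auto simp: induced_by_map_Times) (simp add: induced_by_map_def)
    qed
    then show "{l \<in> space M. \<not> (T l \<in> borel_measurable borel \<and> (\<forall>A\<in>sets borel. \<forall>B\<in>sets borel.
      emeasure (\<pi> l) (A \<times> B) = emeasure (\<mu> l) (A \<inter> T l -` B)))} \<subseteq> N"
      by blast
  qed
  obtain Tj where Tj: "Tj \<in> M \<Otimes>\<^sub>M borel \<rightarrow>\<^sub>M borel" "AE l in M. AE x in \<mu> l. Tj (l, x) = T l x"
    by (rule jointly_measurable_transport_map[OF M \<mu> \<pi> T_\<pi>])
  show ?thesis
  proof (intro bexI[of _ Tj] conjI allI impI)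
    fix S assume S: "AE z in kernel_prod M \<mu>. S z = Tj z"
    show "AE l in M. AE x in \<mu> l. S (l, x) = T l x"
      using AE_kernel_prodD[OF \<mu> S] Tj(2)
    proof eventually_elim
      case (elim l)
      then show ?case by eventually_elim simp
    qed
    have "Tj \<in> kernel_prod M \<mu> \<rightarrow>\<^sub>M borel"
    proof (cases "space M = {}")
      case True
      then have "space (kernel_prod M \<mu>) = {}"
        by (simp add: kernel_prod_def bind_empty)
      then show ?thesis by (auto simp: measurable_def)
    next
      case False
      show ?thesis
        using Tj(1) unfolding measurable_cong_sets[OF sets_kernel_prod[OF False] refl] .
    qed
    then show "S \<in> completion (kernel_prod M \<mu>) \<rightarrow>\<^sub>M borel"
      using S by (rule measurable_completion_if_AE_eq)
  qed (use Tj in auto)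
qed

end
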